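(* Let $G$ be of type $\mathbf{G}_2$. (1) The section given by $\mathcal S(s_i)=t_i\sigma_i$ with $c=-1$, $b=-1$ is optimal, in fact a homomorphic section. Moreover, the Tits section $\mathcal N_\circ$ is not optimal, and in fact $\mathcal N_\circ(s_1)^2\ne1$ and $\mathcal N_\circ(s_2)^2\ne1$. There are four order profiles of sections, corresponding to the choice of the lifts of $s_1,s_2$ being of order $2$ or order $4$. One has $(t_1\sigma_1)^2=1$ if and only if $b=-1$, and $(t_2\sigma_2)^2=1$ if and only if $c=-1$. In particular, the section which lifts $s_2$ to an order $4$ element and $s_1$ to an order $2$ element is given by $b=-1$ and $c=1$, and the section which lifts $s_1$ to an order $4$ element and $s_2$ to an order $2$ element is given by $b=1$ and $c=-1$. (2) Two sections are $T$-conjugate if and only if they have the same value of $b$ and $c$. In particular, two sections are $T$-conjugate if and only if they have the same order profile.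
   Context: $F$ is an algebraically closed field, $G$ an almost-simple connected reductive group over $F$, $T$ a maximal torus, $N=N_G(T)$, $W=N/T$, $\pi:N\to W$ the projection. The simple roots are $\alpha_1=e_1-e_2$ and $\alpha_2=-2e_1+e_2+e_3$; $s_i$ are the corresponding reflections and $\alpha_i^\vee$ the simple coroots. Fix a realization of the root system: isomorphisms $u_\alpha:\mathbf G_a\to U_\alpha$ onto the root subgroups with $tu_\alpha(x)t^{-1}=u_\alpha(\alpha(t)x)$, such that $\sigma_\alpha=u_\alpha(1)u_{-\alpha}(-1)u_\alpha(1)\in N$ maps to $s_\alpha$ and $u_\alpha(x)u_{-\alpha}(-x^{-1})u_\alpha(x)=\alpha^\vee(x)\sigma_\alpha$ for $x\in F^\times$; put $\sigma_i=\sigma_{\alpha_i}$. A section is a map $\mathcal S:W\to N$ with $\pi\circ\mathcal S=\mathrm{id}$ satisfying the braid relations (equivalently $\mathcal S$ is multiplicative along reduced expressions). It is determined by $\mathcal S(s_i)=t_i\sigma_i$, $t_i\in T$; $\mathcal S(s_i)$ is the lift of $s_i$. The Tits section $\mathcal N_\circ$ is the one with all $t_i=1$. A section is homomorphic if it is a group homomorphism. The order profile of $\mathcal S$ is the Dynkin diagram with the node of each $\alpha_i$ labeled by the order of $\mathcal S(s_i)$. For two sections write $\mathcal S'<\mathcal S$ if the order of $\mathcal S'(s_i)$ is greater than the order of $\mathcal S(s_i)$ for all $i$; this translates to a partial order on order profiles, and a section is called optimal if it has the unique maximal order profile with respect to this partial order. Two sections $\mathcal S,\mathcal S'$ are $T$-conjugate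 if there is $t\in T$ with $t\mathcal S(w)t^{-1}=\mathcal S'(w)$ for all $w\in W$. Coordinates: $(x_1,x_2)$ denotes $\alpha_1^\vee(x_1)\alpha_2^\vee(x_2)\in T$. The sections are exactly those given by $t_1=(a,b)$, $t_2=(c,d)$ with $a,d\in F^\times$ arbitrary and $b,c\in F^\times$ with $b^2=c^2=1$.
   Formalization: Non-optimality and nontrivial squares of the Tits section, the four order profiles and the order-4 descriptions are stated only for char F ≠ 2 (false in char 2, where -1 = 1); S' < S means orders at least as large at every node and not all equal, since with strict order none is optimal. *)

theory Defs
  imports "HOL-Analysis.Analysis" "HOL-Algebra.Multiplicative_Group" "HOL-Algebra.Group_Action" "HOL-Library.Extended_Nat"
    "HOL-Computational_Algebra.Polynomial"
begin

section \<open>Linear algebraic groups\<close>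

text \<open>
  A variety over the algebraically closed field is identified with its set of rational points; a
  linear algebraic group is a Zariski closed subgroup of some \<open>GL\<^sub>n\<close>.  The index type \<open>'n\<close> is an
  arbitrary finite type.
\<close>

definition GL :: "('f::field^'n^'n) monoid" where
  "GL = \<lparr>carrier = {A. invertible A}, mult = (**), one = mat 1\<rparr>"

abbreviation grp :: "('f::field^'n^'n) set \<Rightarrow> ('f^'n^'n) monoid" where
  "grp H \<equiv> GL\<lparr>carrier := H\<rparr>"

abbreviation mconj :: "'f::field^'n^'n \<Rightarrow> 'f^'n^'n \<Rightarrow> 'f^'n^'n" where
  "mconj g A \<equiv> g ** A ** matrix_inv g"

inductive_set polyfun :: "('f::field^'n^'n \<Rightarrow> 'f) set" where
  const: "(\<lambda>A. c) \<in> polyfun"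
| entry: "(\<lambda>A. A $ i $ j) \<in> polyfun"
| add: "p \<in> polyfun \<Longrightarrow> q \<in> polyfun \<Longrightarrow> (\<lambda>A. p A + q A) \<in> polyfun"
| mult: "p \<in> polyfun \<Longrightarrow> q \<in> polyfun \<Longrightarrow> (\<lambda>A. p A * q A) \<in> polyfun"

definition zariski_closed :: "('f::field^'n^'n) set \<Rightarrow> bool" where
  "zariski_closed S \<longleftrightarrow> (\<exists>P \<subseteq> polyfun. S = {A. invertible A \<and> (\<forall>p\<in>P. p A = 0)})"

definition zariski_connected :: "('f::field^'n^'n) set \<Rightarrow> bool" where
  "zariski_connected S \<longleftrightarrow>
     \<not> (\<exists>A B. zariski_closed A \<and> zariski_closed B \<and> A \<noteq> {} \<and> B \<noteq> {} \<and> A \<inter> B = {} \<and> A \<union> B = S)"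

text \<open>The coordinate ring of \<open>GL\<^sub>n\<close> is generated by the matrix entries and the inverse determinant;
  regular functions on a closed subset are restrictions of these.\<close>

definition regular_on :: "('f::field^'n^'n) set \<Rightarrow> ('f^'n^'n \<Rightarrow> 'f) \<Rightarrow> bool" where
  "regular_on S f \<longleftrightarrow> (\<exists>p\<in>polyfun. \<exists>k::nat. \<forall>A\<in>S. f A = p A / det A ^ k)"

definition algebraic_group :: "('f::field^'n^'n) set \<Rightarrow> bool" where
  "algebraic_group G \<longleftrightarrow> subgroup G GL \<and> zariski_closed G"

definition unipotent :: "'f::field^'n^'n \<Rightarrow> bool" where
  "unipotent A \<longleftrightarrow> (\<exists>k::nat. (((**) (A - mat 1)) ^^ k) (mat 1) = 0)"

definition closed_connected_normal :: "('f::field^'n^'n) set \<Rightarrow> ('f^'n^'n) set \<Rightarrow> bool" where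
  "closed_connected_normal H G \<longleftrightarrow> zariski_closed H \<and> zariski_connected H \<and> H \<lhd> grp G"

definition connected_reductive :: "('f::field^'n^'n) set \<Rightarrow> bool" where
  "connected_reductive G \<longleftrightarrow> algebraic_group G \<and> zariski_connected G \<and>
     (\<forall>H. closed_connected_normal H G \<and> (\<forall>A\<in>H. unipotent A) \<longrightarrow> H = {mat 1})"

definition almost_simple :: "('f::field^'n^'n) set \<Rightarrow> bool" where
  "almost_simple G \<longleftrightarrow> \<not> comm_group (grp G) \<and>
     (\<forall>H. closed_connected_normal H G \<longrightarrow> H = {mat 1} \<or> H = G)"

text \<open>Over an algebraically closed field, tori are the connected diagonalizable groups.\<close>

definition torus :: "('f::field^'n^'n) set \<Rightarrow> bool" where
  "torus T \<longleftrightarrow> algebraic_group T \<and> zariski_connected T \<and>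
     (\<exists>P. invertible P \<and> (\<forall>t\<in>T. \<forall>i j. i \<noteq> j \<longrightarrow> mconj P t $ i $ j = 0))"

definition maximal_torus :: "('f::field^'n^'n) set \<Rightarrow> ('f^'n^'n) set \<Rightarrow> bool" where
  "maximal_torus T G \<longleftrightarrow> torus T \<and> T \<subseteq> G \<and> (\<forall>T'. torus T' \<and> T \<subseteq> T' \<and> T' \<subseteq> G \<longrightarrow> T' = T)"

definition characters :: "('f::field^'n^'n) set \<Rightarrow> ('f^'n^'n \<Rightarrow> 'f) set" where
  "characters T = {f \<in> extensional T. regular_on T f \<and> (\<forall>t\<in>T. f t \<noteq> 0) \<and>
     (\<forall>s\<in>T. \<forall>t\<in>T. f (s ** t) = f s * f t)}"

text \<open>Only the values of a cocharacter on nonzero scalars are meaningful.\<close>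

definition cocharacter :: "('f::field^'n^'n) set \<Rightarrow> ('f \<Rightarrow> 'f^'n^'n) \<Rightarrow> bool" where
  "cocharacter T \<mu> \<longleftrightarrow> (\<forall>x. x \<noteq> 0 \<longrightarrow> \<mu> x \<in> T) \<and>
     (\<forall>x y. x \<noteq> 0 \<longrightarrow> y \<noteq> 0 \<longrightarrow> \<mu> (x * y) = \<mu> x ** \<mu> y) \<and>
     (\<forall>i j. \<exists>(p :: 'f poly) (k::nat). \<forall>x. x \<noteq> 0 \<longrightarrow> \<mu> x $ i $ j = poly p x / x ^ k)"

text \<open>The tangent space at the identity: a polynomial vanishing on \<open>G\<close> has vanishing first order
  term along the line \<open>1 + eY\<close>.  Here \<open>mat e ** Y\<close> is the scalar multiple \<open>eY\<close>.\<close>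

definition lie_algebra :: "('f::field^'n^'n) set \<Rightarrow> ('f^'n^'n) set" where
  "lie_algebra G = {Y. \<forall>p\<in>polyfun. (\<forall>A\<in>G. p A = 0) \<longrightarrow>
     (\<exists>q :: 'f poly. \<forall>e. p (mat 1 + mat e ** Y) = e ^ 2 * poly q e)}"

definition group_roots :: "('f::field^'n^'n) set \<Rightarrow> ('f^'n^'n) set \<Rightarrow> ('f^'n^'n \<Rightarrow> 'f) set" where
  "group_roots G T = {\<alpha> \<in> characters T. (\<exists>t\<in>T. \<alpha> t \<noteq> 1) \<and>
     (\<exists>Y \<in> lie_algebra G. Y \<noteq> 0 \<and> (\<forall>t\<in>T. mconj t Y = mat (\<alpha> t) ** Y))}"

text \<open>Homomorphisms from the additive group that are isomorphisms onto their image.\<close>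

definition additive_embedding :: "('f::field^'n^'n) set \<Rightarrow> ('f \<Rightarrow> 'f^'n^'n) \<Rightarrow> bool" where
  "additive_embedding G u \<longleftrightarrow> range u \<subseteq> G \<and> (\<forall>x y. u (x + y) = u x ** u y) \<and>
     (\<forall>i j. \<exists>p :: 'f poly. \<forall>x. u x $ i $ j = poly p x) \<and>
     (\<exists>q. regular_on (range u) q \<and> (\<forall>x. q (u x) = x))"


section \<open>The root system of type \<open>G\<^sub>2\<close>\<close>

abbreviation ee :: "3 \<Rightarrow> int^3" where "ee i \<equiv> axis i 1"

definition G2_roots :: "(int^3) set" where
  "G2_roots = {ee i - ee j |i j. i \<noteq> j} \<union>
     (\<Union>i j k. if i \<noteq> j \<and> j \<noteq> k \<and> i \<noteq> k
        then {ee j + ee k - 2 *s ee i, 2 *s ee i - ee j - ee k} else {})"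

definition alpha1 :: "int^3" where "alpha1 = ee 1 - ee 2"
definition alpha2 :: "int^3" where "alpha2 = ee 2 + ee 3 - 2 *s ee 1"

definition root_lattice :: "(int^3) set" where
  "root_lattice = {v. (\<Sum>i\<in>UNIV. v $ i) = 0}"

definition dot :: "int^3 \<Rightarrow> int^3 \<Rightarrow> int" where
  "dot v w = (\<Sum>i\<in>UNIV. v $ i * w $ i)"

text \<open>The Cartan integer \<open>\<langle>b, a\<^sup>\<or>\<rangle>\<close>; the division is exact on roots.\<close>

definition cartan :: "int^3 \<Rightarrow> int^3 \<Rightarrow> int" where
  "cartan b a = 2 * dot b a div dot a a"


section \<open>Realized groups of type \<open>G\<^sub>2\<close>\<close>

text \<open>A group \<open>gp\<close>, a torus \<open>tor\<close>, the character \<open>chr v\<close> attached to an element \<open>v\<close> of the root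
  lattice, the coroot \<open>cor a\<close> and the root homomorphism \<open>ru a\<close> attached to a root \<open>a\<close>.  Values at
  other elements of \<open>int^3\<close> are irrelevant.\<close>

record ('f, 'n) datum =
  gp :: "('f^'n^'n) set"
  tor :: "('f^'n^'n) set"
  chr :: "int^3 \<Rightarrow> 'f^'n^'n \<Rightarrow> 'f"
  cor :: "int^3 \<Rightarrow> 'f \<Rightarrow> 'f^'n^'n"
  ru :: "int^3 \<Rightarrow> 'f \<Rightarrow> 'f^'n^'n"

text \<open>The root system of \<open>(G,T)\<close> in \<open>X(T) \<otimes> \<real>\<close> is isomorphic, via \<open>chr\<close>, to the one above: \<open>chr\<close>
  identifies the root lattices and the sets of roots, the roots span \<open>X(T) \<otimes> \<real>\<close>, and \<open>cor\<close> consists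
  of the corresponding coroots.\<close>

definition type_G2 :: "('f::field, 'n::finite) datum \<Rightarrow> bool" where
  "type_G2 D \<longleftrightarrow>
     chr D ` root_lattice \<subseteq> characters (tor D) \<and> inj_on (chr D) root_lattice \<and>
     (\<forall>v\<in>root_lattice. \<forall>w\<in>root_lattice. \<forall>t\<in>tor D. chr D (v + w) t = chr D v t * chr D w t) \<and>
     chr D ` G2_roots = group_roots (gp D) (tor D) \<and>
     (\<forall>f\<in>characters (tor D). \<exists>k::nat. k > 0 \<and>
        (\<exists>v\<in>root_lattice. \<forall>t\<in>tor D. f t ^ k = chr D v t)) \<and>
     (\<forall>a\<in>G2_roots. cocharacter (tor D) (cor D a) \<and>
        (\<forall>b\<in>G2_roots. \<forall>x. x \<noteq> 0 \<longrightarrow> chr D b (cor D a x) = x powi cartan b a))"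

definition nrm :: "('f::field, 'n::finite) datum \<Rightarrow> ('f^'n^'n) set" where
  "nrm D = normalizer (grp (gp D)) (tor D)"

definition weyl :: "('f::field, 'n::finite) datum \<Rightarrow> ('f^'n^'n) set monoid" where
  "weyl D = grp (nrm D) Mod tor D"

definition weyl_proj :: "('f::field, 'n::finite) datum \<Rightarrow> 'f^'n^'n \<Rightarrow> ('f^'n^'n) set" where
  "weyl_proj D n = tor D #>\<^bsub>GL\<^esub> n"

text \<open>The element \<open>s\<^sub>a\<close> of \<open>N/T\<close>, as a coset: all elements of \<open>N\<close> that act on \<open>T\<close> by
  \<open>t \<mapsto> t a\<^sup>\<or>(a(t))\<inverse>\<close>, the dual of the reflection \<open>\<chi> \<mapsto> \<chi> - \<langle>\<chi>, a\<^sup>\<or>\<rangle> a\<close> of \<open>X(T)\<close>.  As \<open>T\<close> is its own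
  centralizer in the reductive group \<open>G\<close>, these elements form a single coset of \<open>T\<close>.\<close>

definition reflection :: "('f::field, 'n::finite) datum \<Rightarrow> int^3 \<Rightarrow> ('f^'n^'n) set" where
  "reflection D a = {n \<in> nrm D. \<forall>t\<in>tor D. mconj n t = t ** cor D a (inverse (chr D a t))}"

definition sigma_lift :: "('f::field, 'n::finite) datum \<Rightarrow> int^3 \<Rightarrow> 'f^'n^'n" where
  "sigma_lift D a = ru D a 1 ** ru D (- a) (- 1) ** ru D a 1"

definition realization :: "('f::field, 'n::finite) datum \<Rightarrow> bool" where
  "realization D \<longleftrightarrow> (\<forall>a\<in>G2_roots.
     additive_embedding (gp D) (ru D a) \<and>
     (\<forall>t\<in>tor D. \<forall>x. mconj t (ru D a x) = ru D a (chr D a t * x)) \<and>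
     sigma_lift D a \<in> nrm D \<and> weyl_proj D (sigma_lift D a) = reflection D a \<and>
     (\<forall>x. x \<noteq> 0 \<longrightarrow>
        ru D a x ** ru D (- a) (- inverse x) ** ru D a x = cor D a x ** sigma_lift D a))"


section \<open>Sections of the Weyl group\<close>

definition simple_refls :: "('f::field, 'n::finite) datum \<Rightarrow> ('f^'n^'n) set set" where
  "simple_refls D = {reflection D alpha1, reflection D alpha2}"

definition word_prod :: "('f::field, 'n::finite) datum \<Rightarrow> ('f^'n^'n) set list \<Rightarrow> ('f^'n^'n) set" where
  "word_prod D ws = foldr (\<otimes>\<^bsub>weyl D\<^esub>) ws \<one>\<^bsub>weyl D\<^esub>"

definition reduced :: "('f::field, 'n::finite) datum \<Rightarrow> ('f^'n^'n) set list \<Rightarrow> bool" where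
  "reduced D ws \<longleftrightarrow> set ws \<subseteq> simple_refls D \<and>
     (\<forall>vs. set vs \<subseteq> simple_refls D \<and> word_prod D vs = word_prod D ws \<longrightarrow> length ws \<le> length vs)"

text \<open>Sections are extensional, so that they are determined by their values on \<open>W\<close>.\<close>

definition is_section ::
    "('f::field, 'n::finite) datum \<Rightarrow> (('f^'n^'n) set \<Rightarrow> 'f^'n^'n) \<Rightarrow> bool" where
  "is_section D S \<longleftrightarrow> S \<in> carrier (weyl D) \<rightarrow>\<^sub>E nrm D \<and>
     (\<forall>w\<in>carrier (weyl D). weyl_proj D (S w) = w) \<and>
     (\<forall>ws. reduced D ws \<longrightarrow> S (word_prod D ws) = foldr (**) (map S ws) (mat 1))"

definition homomorphic ::
    "('f::field, 'n::finite) datum \<Rightarrow> (('f^'n^'n) set \<Rightarrow> 'f^'n^'n) \<Rightarrow> bool" where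
  "homomorphic D S \<longleftrightarrow> is_section D S \<and> S \<in> hom (weyl D) (grp (nrm D))"

definition coord :: "('f::field, 'n::finite) datum \<Rightarrow> 'f \<Rightarrow> 'f \<Rightarrow> 'f^'n^'n" where
  "coord D x1 x2 = cor D alpha1 x1 ** cor D alpha2 x2"

definition section_with :: "('f::field, 'n::finite) datum \<Rightarrow> 'f \<Rightarrow> 'f \<Rightarrow> 'f \<Rightarrow> 'f \<Rightarrow>
    (('f^'n^'n) set \<Rightarrow> 'f^'n^'n) \<Rightarrow> bool" where
  "section_with D a b c d S \<longleftrightarrow> is_section D S \<and> a \<noteq> 0 \<and> b \<noteq> 0 \<and> c \<noteq> 0 \<and> d \<noteq> 0 \<and>
     S (reflection D alpha1) = coord D a b ** sigma_lift D alpha1 \<and>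
     S (reflection D alpha2) = coord D c d ** sigma_lift D alpha2"

definition tits_section ::
    "('f::field, 'n::finite) datum \<Rightarrow> (('f^'n^'n) set \<Rightarrow> 'f^'n^'n) \<Rightarrow> bool" where
  "tits_section D S \<longleftrightarrow> is_section D S \<and>
     S (reflection D alpha1) = sigma_lift D alpha1 \<and> S (reflection D alpha2) = sigma_lift D alpha2"

text \<open>\<open>group.ord\<close> is \<open>0\<close> for elements of infinite order.\<close>

definition elt_order :: "'f::field^'n^'n \<Rightarrow> enat" where
  "elt_order A = (if group.ord GL A = 0 then \<infinity> else enat (group.ord GL A))"

text \<open>The labels of the nodes \<open>\<alpha>\<^sub>1\<close>, \<open>\<alpha>\<^sub>2\<close> of the (fixed) Dynkin diagram.\<close>

definition order_profile ::
    "('f::field, 'n::finite) datum \<Rightarrow> (('f^'n^'n) set \<Rightarrow> 'f^'n^'n) \<Rightarrow> enat \<times> enat" where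
  "order_profile D S = (elt_order (S (reflection D alpha1)), elt_order (S (reflection D alpha2)))"

definition order_profiles :: "('f::field, 'n::finite) datum \<Rightarrow> (enat \<times> enat) set" where
  "order_profiles D = order_profile D ` {S. is_section D S}"

text \<open>A profile is smaller if its orders are larger: \<open>p < q\<close> when every label of \<open>p\<close> is at least
  that of \<open>q\<close>, and \<open>p \<noteq> q\<close>.\<close>

definition profile_less :: "enat \<times> enat \<Rightarrow> enat \<times> enat \<Rightarrow> bool" where
  "profile_less p q \<longleftrightarrow> fst p \<ge> fst q \<and> snd p \<ge> snd q \<and> p \<noteq> q"

definition maximal_profile :: "('f::field, 'n::finite) datum \<Rightarrow> enat \<times> enat \<Rightarrow> bool" where
  "maximal_profile D p \<longleftrightarrow> p \<in> order_profiles D \<and> \<not> (\<exists>q\<in>order_profiles D. profile_less p q)"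

definition optimal ::
    "('f::field, 'n::finite) datum \<Rightarrow> (('f^'n^'n) set \<Rightarrow> 'f^'n^'n) \<Rightarrow> bool" where
  "optimal D S \<longleftrightarrow> is_section D S \<and> (\<forall>p. maximal_profile D p \<longleftrightarrow> p = order_profile D S)"

definition T_conjugate :: "('f::field, 'n::finite) datum \<Rightarrow> (('f^'n^'n) set \<Rightarrow> 'f^'n^'n) \<Rightarrow>
    (('f^'n^'n) set \<Rightarrow> 'f^'n^'n) \<Rightarrow> bool" where
  "T_conjugate D S S' \<longleftrightarrow> (\<exists>t\<in>tor D. \<forall>w\<in>carrier (weyl D). mconj t (S w) = S' w)"

end

theory Submission
  imports Defs
begin

text \<open>
  The proof is a computation inside the extension of \<open>W\<close> by \<open>T\<close> given by the normalizer \<open>N\<close>.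
  Three facts about this extension carry everything.

  The pairing between the root lattice of \<open>G\<^sub>2\<close> and the coroot lattice is perfect, so
  \<open>(x\<^sub>1, x\<^sub>2) \<mapsto> \<alpha>\<^sub>1\<^sup>\<or>(x\<^sub>1) \<alpha>\<^sub>2\<^sup>\<or>(x\<^sub>2)\<close> is a bijection onto \<open>T\<close>, as is \<open>(\<alpha>\<^sub>1, \<alpha>\<^sub>2)\<close> from \<open>T\<close> to pairs
  of nonzero scalars (\<open>tor_eq_coord\<close>, \<open>coord_eq_iff\<close>).  The simple reflections act on coordinates
  by \<open>(x, y) \<mapsto> (y / x, y)\<close> and \<open>(x, y) \<mapsto> (x, x\<^sup>3 / y)\<close>.

  An element of \<open>N\<close> permutes the roots additively, there are exactly twelve ways to do so, and each
  of them comes from one of twelve alternating words in the simple reflections.  An element of \<open>N\<close>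
  that centralizes \<open>T\<close> lies in \<open>T\<close>, because the lifts of a reflection form a single coset of \<open>T\<close>.
  Hence \<open>W\<close> is dihedral of order twelve (\<open>nrm_eq_tor_lift\<close>, \<open>lift_coset_iff\<close>).

  Comparing the realization at \<open>x = -1\<close> with its value at \<open>x = 1\<close> gives \<open>\<sigma>\<^sub>\<alpha>\<^sup>2 = \<alpha>\<^sup>\<or>(-1)\<close>
  (\<open>sigma_square\<close>), so the lifts \<open>n\<^sub>1 = (a, b) \<sigma>\<^sub>1\<close> and \<open>n\<^sub>2 = (c, d) \<sigma>\<^sub>2\<close> have squares \<open>(-b, b\<^sup>2)\<close> and
  \<open>(c\<^sup>2, -c\<^sup>3)\<close>.  Thus \<open>n\<^sub>1\<^sup>4 = 1\<close> exactly when \<open>b\<^sup>2 = 1\<close>, \<open>n\<^sub>2\<^sup>4 = 1\<close> exactly when \<open>c\<^sup>2 = 1\<close>, and in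
  that case the squares are trivial exactly when \<open>b = -1\<close>, respectively \<open>c = -1\<close>.

  The decisive point is that lifts \<open>n\<^sub>1, n\<^sub>2\<close> satisfy the braid relation if and only if
  \<open>n\<^sub>1\<^sup>4 = n\<^sub>2\<^sup>4 = 1\<close>.  Put \<open>A = (n\<^sub>1 n\<^sub>2)\<^sup>3\<close> and \<open>B = (n\<^sub>2 n\<^sub>1)\<^sup>3\<close>; both act on \<open>T\<close> by inversion, since the
  longest element of \<open>W\<close> is \<open>-1\<close>.  If \<open>A = B\<close>, then \<open>A\<close> commutes with \<open>n\<^sub>i\<close>, hence with \<open>n\<^sub>i\<^sup>2\<close>, an
  element of \<open>T\<close> that \<open>A\<close> inverts, and so \<open>n\<^sub>i\<^sup>4 = 1\<close> (\<open>braid_imp_fourth_power\<close>).  Conversely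
  \<open>A = t B\<close> for some \<open>t\<close> in \<open>T\<close>, and \<open>n\<^sub>i\<^sup>4 = 1\<close> makes \<open>n\<^sub>i\<^sup>2\<close> its own inverse, so that
  it commutes with \<open>A\<close>; this yields \<open>t n\<^sub>i t = n\<^sub>i\<close>, so both simple reflections invert \<open>t\<close>.  In coordinates this
  forces \<open>t = 1\<close> (\<open>fourth_power_imp_braid\<close>).  With all \<open>t\<^sub>i = 1\<close> this yields the Tits section.

  Sections are therefore the choices of nonzero \<open>a, b, c, d\<close> with \<open>b\<^sup>2 = c\<^sup>2 = 1\<close>.  Their order profiles are
  read off from the squares; with \<open>b = c = -1\<close> both lifts are involutions satisfying the braid
  relation, so the section is a homomorphism.  Conjugation by \<open>t\<close> in \<open>T\<close> multiplies \<open>a\<close> by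
  \<open>\<alpha>\<^sub>1(t)\<close> and \<open>d\<close> by \<open>\<alpha>\<^sub>2(t)\<close> and fixes \<open>b\<close> and \<open>c\<close>; since \<open>(\<alpha>\<^sub>1(t), \<alpha>\<^sub>2(t))\<close> is arbitrary, the pair
  \<open>(b, c)\<close> classifies sections up to conjugacy (\<open>T_conjugate_iff\<close>).
\<close>


section \<open>Invertible matrices and regular functions\<close>

lemma matrix_inv_inverts:
  fixes A :: "'f::field^'n^'n"
  assumes "invertible A"
  shows "A ** matrix_inv A = mat 1" "matrix_inv A ** A = mat 1"
proof -
  have "A ** matrix_inv A = mat 1 \<and> matrix_inv A ** A = mat 1"
    using assms unfolding invertible_def matrix_inv_def by (rule someI_ex)
  then show "A ** matrix_inv A = mat 1" "matrix_inv A ** A = mat 1" by auto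
qed

lemma invertible_matrix_inv:
  fixes A :: "'f::field^'n^'n"
  assumes "invertible A"
  shows "invertible (matrix_inv A)"
  using matrix_inv_inverts[OF assms] unfolding invertible_def by blast

lemma matrix_left_cancel:
  fixes A :: "'f::field^'n^'n"
  assumes "invertible A" "A ** B = A ** C"
  shows "B = C"
  by (metis assms matrix_inv_inverts(2) matrix_mul_assoc matrix_mul_lid)

lemma matrix_right_cancel:
  fixes A :: "'f::field^'n^'n"
  assumes "invertible A" "B ** A = C ** A"
  shows "B = C"
  by (metis assms matrix_inv_inverts(1) matrix_mul_assoc matrix_mul_rid)

lemma mconj_eq_iff:
  fixes A :: "'f::field^'n^'n"
  assumes "invertible A"
  shows "mconj A B = C \<longleftrightarrow> A ** B = C ** A"
proof
  assume "mconj A B = C"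
  then have "C ** A = A ** B ** (matrix_inv A ** A)" by (simp add: matrix_mul_assoc)
  then show "A ** B = C ** A" by (simp add: matrix_inv_inverts[OF assms])
next
  assume "A ** B = C ** A"
  then have "mconj A B = C ** (A ** matrix_inv A)" by (simp add: matrix_mul_assoc)
  then show "mconj A B = C" by (simp add: matrix_inv_inverts[OF assms])
qed

lemma mconj_mult:
  fixes A :: "'f::field^'n^'n"
  assumes "invertible A"
  shows "mconj A (B ** C) = mconj A B ** mconj A C"
proof -
  have "mconj A B ** mconj A C = A ** B ** (matrix_inv A ** A) ** C ** matrix_inv A"
    by (simp add: matrix_mul_assoc)
  then show ?thesis by (simp add: matrix_inv_inverts[OF assms] matrix_mul_assoc)
qed

lemma matrix_inv_unique:
  fixes A :: "'f::field^'n^'n"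
  assumes "A ** B = mat 1"
  shows "matrix_inv A = B" "invertible A"
proof -
  show A: "invertible A" using assms invertible_right_inverse by blast
  show "matrix_inv A = B"
    using matrix_inv_inverts(1)[OF A] assms matrix_left_cancel[OF A] by metis
qed

lemma mconj_mconj:
  fixes A B :: "'f::field^'n^'n"
  assumes "invertible A" "invertible B"
  shows "mconj A (mconj B C) = mconj (A ** B) C"
proof -
  have "A ** B ** (matrix_inv B ** matrix_inv A) = A ** (B ** matrix_inv B) ** matrix_inv A"
    by (simp add: matrix_mul_assoc)
  then have "matrix_inv (A ** B) = matrix_inv B ** matrix_inv A"
    by (intro matrix_inv_unique) (simp add: matrix_inv_inverts assms)
  then show ?thesis by (simp add: matrix_mul_assoc)
qed

lemma mconj_add: "mconj n (A + B) = mconj n A + mconj n (B :: 'f::field^'n^'n)"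
  by (simp add: vec_eq_iff matrix_matrix_mult_def algebra_simps sum.distrib)

lemma mat_scalar_commute: "mat e ** A = A ** mat e"
  for A :: "'f::field^'n^'n"
  by (simp add: vec_eq_iff matrix_matrix_mult_def mat_def if_distrib if_distribR mult.commute
      cong: if_cong)

lemma mconj_one: "mconj (mat 1) A = (A :: 'f::field^'n^'n)"
  using matrix_inv_unique(1)[of "mat 1 :: 'f^'n^'n" "mat 1"] by simp

lemma mconj_scalar: "mconj n (mat e ** A) = mat e ** mconj n (A :: 'f::field^'n^'n)"
  by (simp add: matrix_mul_assoc mat_scalar_commute[of e n])

lemma GL_simps [simp]:
  "carrier GL = {A :: 'f::field^'n^'n. invertible A}"
  "mult GL = ((**) :: 'f^'n^'n \<Rightarrow> _)" "one GL = (mat 1 :: 'f^'n^'n)"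
  by (simp_all add: GL_def)

lemma group_GL: "group (GL :: ('f::field^'n^'n) monoid)"
proof (rule groupI)
  fix x y z :: "'f^'n^'n"
  show "x \<in> carrier GL \<Longrightarrow> \<exists>y\<in>carrier GL. y \<otimes>\<^bsub>GL\<^esub> x = \<one>\<^bsub>GL\<^esub>"
    using matrix_inv_inverts invertible_matrix_inv by auto
  show "\<one>\<^bsub>GL\<^esub> \<in> carrier (GL :: ('f^'n^'n) monoid)"
    using matrix_inv_unique(2)[of "mat 1 :: 'f^'n^'n" "mat 1"] by simp
qed (auto simp: invertible_mult matrix_mul_assoc)

lemma inv_GL: "invertible A \<Longrightarrow> inv\<^bsub>GL\<^esub> A = matrix_inv (A :: 'f::field^'n^'n)"
  by (rule group.inv_equality[OF group_GL])
     (auto simp: matrix_inv_inverts invertible_matrix_inv)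

lemma polyfun_sum:
  assumes "finite I" "\<And>i. i \<in> I \<Longrightarrow> f i \<in> polyfun"
  shows "(\<lambda>A. \<Sum>i\<in>I. f i A) \<in> polyfun"
  using assms by (induction I) (auto intro: polyfun.intros)

lemma polyfun_prod:
  assumes "finite I" "\<And>i. i \<in> I \<Longrightarrow> f i \<in> polyfun"
  shows "(\<lambda>A. \<Prod>i\<in>I. f i A) \<in> polyfun"
  using assms by (induction I) (auto intro: polyfun.intros)

lemma polyfun_power: "f \<in> polyfun \<Longrightarrow> (\<lambda>A. f A ^ k) \<in> polyfun"
  by (induction k) (auto intro: polyfun.intros)

lemma polyfun_det: "det \<in> polyfun"
  unfolding det_def[abs_def]
  by (intro polyfun_sum polyfun.mult polyfun.const polyfun_prod polyfun.entry) auto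

lemma polyfun_mult_entry:
  assumes "\<And>i j. (\<lambda>A. B A $ i $ j) \<in> polyfun" "\<And>i j. (\<lambda>A. C A $ i $ j) \<in> polyfun"
  shows "(\<lambda>A. (B A ** C A) $ i $ j) \<in> polyfun"
  unfolding matrix_matrix_mult_def using assms
  by (simp, intro polyfun_sum polyfun.mult) auto

lemma polyfun_compose:
  assumes "p \<in> polyfun" "\<And>i j. (\<lambda>A. B A $ i $ j) \<in> polyfun"
  shows "(\<lambda>A. p (B A)) \<in> polyfun"
  using assms by (induction p) (auto intro: polyfun.intros)

lemma polyfun_mconj_entry: "(\<lambda>A. mconj n A $ i $ j) \<in> polyfun"
  by (intro polyfun_mult_entry polyfun.const polyfun.entry)

lemma det_nonzero: "invertible (A :: 'f::field^'n^'n) \<Longrightarrow> det A \<noteq> 0"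
  by (simp add: invertible_det_nz)

lemma regular_on_cong:
  assumes "\<And>A. A \<in> S \<Longrightarrow> f A = g A"
  shows "regular_on S f \<longleftrightarrow> regular_on S g"
  using assms by (simp add: regular_on_def)

lemma regular_on_polyfun: "p \<in> polyfun \<Longrightarrow> regular_on S p"
  unfolding regular_on_def by (intro bexI[of _ p] exI[of _ 0]) auto

lemma regular_on_mult:
  assumes "regular_on S f" "regular_on S g"
  shows "regular_on S (\<lambda>A. f A * g A)"
proof -
  obtain p k q m where pq: "p \<in> polyfun" "q \<in> polyfun"
    "\<forall>A\<in>S. f A = p A / det A ^ k" "\<forall>A\<in>S. g A = q A / det A ^ m"
    using assms unfolding regular_on_def by blast
  then have "\<forall>A\<in>S. f A * g A = p A * q A / det A ^ (k + m)"
    by (simp add: power_add)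
  with pq show ?thesis
    unfolding regular_on_def by (intro bexI[of _ "\<lambda>A. p A * q A"] exI[of _ "k + m"]) (auto intro: polyfun.mult)
qed

lemma regular_on_add:
  assumes S: "\<And>A. A \<in> S \<Longrightarrow> invertible A" and "regular_on S f" "regular_on S g"
  shows "regular_on S (\<lambda>A. f A + g A)"
proof -
  obtain p k q m where pq: "p \<in> polyfun" "q \<in> polyfun"
    "\<forall>A\<in>S. f A = p A / det A ^ k" "\<forall>A\<in>S. g A = q A / det A ^ m"
    using assms unfolding regular_on_def by blast
  have "\<forall>A\<in>S. f A + g A = (p A * det A ^ m + q A * det A ^ k) / det A ^ (k + m)"
  proof
    fix A assume "A \<in> S"
    then have "det A \<noteq> 0" by (intro det_nonzero S)
    then show "f A + g A = (p A * det A ^ m + q A * det A ^ k) / det A ^ (k + m)"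
      using pq(3,4) \<open>A \<in> S\<close> by (simp add: power_add add_divide_distrib)
  qed
  moreover have "(\<lambda>A. p A * det A ^ m + q A * det A ^ k) \<in> polyfun"
    using pq by (intro polyfun.add polyfun.mult polyfun_power polyfun_det)
  ultimately show ?thesis unfolding regular_on_def
    by (intro bexI[of _ "\<lambda>A. p A * det A ^ m + q A * det A ^ k"] exI[of _ "k + m"])
qed

lemma regular_on_sum:
  assumes "\<And>A. A \<in> S \<Longrightarrow> invertible A" "finite I" "\<And>i. i \<in> I \<Longrightarrow> regular_on S (f i)"
  shows "regular_on S (\<lambda>A. \<Sum>i\<in>I. f i A)"
  using assms(2,3)
  by (induction I) (auto intro: regular_on_add[OF assms(1)] regular_on_polyfun polyfun.const)

lemma regular_on_power: "regular_on S f \<Longrightarrow> regular_on S (\<lambda>A. f A ^ k)"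
  by (induction k) (auto intro: regular_on_mult regular_on_polyfun polyfun.const)

lemma regular_on_poly:
  assumes "\<And>A. A \<in> S \<Longrightarrow> invertible A" "regular_on S f"
  shows "regular_on S (\<lambda>A. poly q (f A))"
  unfolding poly_altdef
  by (intro regular_on_sum regular_on_mult regular_on_power assms regular_on_polyfun polyfun.const) auto

lemma regular_on_mult_entry:
  assumes "\<And>A. A \<in> S \<Longrightarrow> invertible A"
    "\<And>i j. regular_on S (\<lambda>A. B A $ i $ j)" "\<And>i j. regular_on S (\<lambda>A. C A $ i $ j)"
  shows "regular_on S (\<lambda>A. (B A ** C A) $ i $ j)"
  unfolding matrix_matrix_mult_def using assms
  by (simp, intro regular_on_sum regular_on_mult) auto

lemma regular_on_mconj:
  assumes f: "regular_on S f" and n: "invertible n" and S: "\<And>A. A \<in> S \<Longrightarrow> mconj n A \<in> S"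
  shows "regular_on S (\<lambda>A. f (mconj n A))"
proof -
  obtain p k where p: "p \<in> polyfun" "\<forall>A\<in>S. f A = p A / det A ^ k"
    using f unfolding regular_on_def by blast
  have "det n * det (matrix_inv n) = 1"
    by (metis det_I det_mul matrix_inv_inverts(1) n)
  then have "det (mconj n A) = det A" for A
    by (simp add: det_mul mult.commute mult.left_commute)
  then have "\<forall>A\<in>S. f (mconj n A) = p (mconj n A) / det A ^ k" using p S by simp
  moreover have "(\<lambda>A. p (mconj n A)) \<in> polyfun"
    by (rule polyfun_compose[OF p(1) polyfun_mconj_entry])
  ultimately show ?thesis unfolding regular_on_def
    by (intro bexI[of _ "\<lambda>A. p (mconj n A)"] exI[of _ k])
qed

text \<open>After multiplication by a power of the determinant, which is invertible on \<open>GL\<^sub>n\<close>, the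
  vanishing of a regular function becomes a polynomial condition.\<close>

lemma zariski_closed_Int_zero:
  assumes S: "zariski_closed S" and f: "regular_on S f"
  shows "zariski_closed {A \<in> S. f A = 0}"
proof -
  obtain P where P: "P \<subseteq> polyfun" "S = {A. invertible A \<and> (\<forall>p\<in>P. p A = 0)}"
    using S unfolding zariski_closed_def by blast
  obtain q k where q: "q \<in> polyfun" "\<forall>A\<in>S. f A = q A / det A ^ k"
    using f unfolding regular_on_def by blast
  have "{A \<in> S. f A = 0} = {A. invertible A \<and> (\<forall>p\<in>insert q P. p A = 0)}"
  proof -
    have "f A = 0 \<longleftrightarrow> q A = 0" if "A \<in> S" for A
      using that P(2) q(2) det_nonzero[of A] by simp
    with P(2) show ?thesis by blast
  qed
  moreover have "insert q P \<subseteq> polyfun" using P(1) q(1) by simp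
  ultimately show ?thesis unfolding zariski_closed_def by (intro exI[of _ "insert q P"]) simp
qed

text \<open>A regular function on a connected set that takes only finitely many values is constant:
  the fibre over one value and the union of the other fibres are both closed.\<close>

lemma connected_finite_image_constant:
  assumes conn: "zariski_connected S" and closed: "zariski_closed S"
    and f: "regular_on S f" and fin: "finite (f ` S)" and A: "A \<in> S" and B: "B \<in> S"
  shows "f A = f B"
proof (rule ccontr)
  assume neq: "f A \<noteq> f B"
  have S: "invertible A" if "A \<in> S" for A using that closed unfolding zariski_closed_def by auto
  define V where "V = f ` S - {f A}"
  have finV: "finite V" using fin V_def by simp
  define q where "q = (\<Prod>v\<in>V. [:- v, 1:])"
  have q0: "poly q x = 0 \<longleftrightarrow> x \<in> V" for x
    unfolding q_def poly_prod using finV by (auto simp: prod_zero_iff)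
  have 1: "zariski_closed {C \<in> S. f C - f A = 0}"
    using regular_on_add[OF S f regular_on_polyfun[OF polyfun.const[of "- f A"]]]
    by (intro zariski_closed_Int_zero[OF closed]) simp
  have 2: "zariski_closed {C \<in> S. poly q (f C) = 0}"
    by (intro zariski_closed_Int_zero[OF closed] regular_on_poly f S)
  have "{C \<in> S. f C - f A = 0} \<union> {C \<in> S. poly q (f C) = 0} = S"
    "{C \<in> S. f C - f A = 0} \<inter> {C \<in> S. poly q (f C) = 0} = {}"
    by (auto simp: q0 V_def)
  moreover have "A \<in> {C \<in> S. f C - f A = 0}" "B \<in> {C \<in> S. poly q (f C) = 0}"
    using A B neq by (auto simp: q0 V_def)
  ultimately show False using conn 1 2 unfolding zariski_connected_def by blast
qed

lemma finite_roots_of_unity: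
  assumes "k > 0"
  shows "finite {x :: 'f::field. x ^ k = 1}"
proof -
  let ?q = "Polynomial.monom 1 k - 1 :: 'f poly"
  have "poly.coeff ?q k = 1" using assms by simp
  then have "?q \<noteq> 0" by (metis coeff_0 zero_neq_one)
  then have "finite {x. poly ?q x = 0}" by (rule poly_roots_finite)
  then show ?thesis by (simp add: poly_monom)
qed


section \<open>The root lattice in simple coordinates\<close>

text \<open>The pair \<open>(x, y)\<close> stands for \<open>x \<alpha>\<^sub>1 + y \<alpha>\<^sub>2\<close>.  In these coordinates questions about
  roots and words become finite computations with pairs of integers.\<close>

definition lat :: "int \<times> int \<Rightarrow> int^3" where
  "lat p = fst p *s alpha1 + snd p *s alpha2"

definition root_coords :: "(int \<times> int) set" where
  "root_coords = {(1,0), (0,1), (1,1), (2,1), (3,1), (3,2),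
    (-1,0), (0,-1), (-1,-1), (-2,-1), (-3,-1), (-3,-2)}"

lemma alpha_nth [simp]:
  "alpha1 $ 1 = 1" "alpha1 $ 2 = -1" "alpha1 $ 3 = 0"
  "alpha2 $ 1 = -2" "alpha2 $ 2 = 1" "alpha2 $ 3 = 1"
  by (simp_all add: alpha1_def alpha2_def axis_def)

lemma lat_nth [simp]:
  "lat (x, y) $ 1 = x - 2 * y" "lat (x, y) $ 2 = y - x" "lat (x, y) $ 3 = y"
  by (simp_all add: lat_def)

lemma vec3_eq_iff: "v = w \<longleftrightarrow> v $ 1 = w $ 1 \<and> v $ 2 = w $ 2 \<and> v $ 3 = (w :: int^3) $ 3"
  by (simp add: vec_eq_iff forall_3)

lemma lat_simple: "lat (1, 0) = alpha1" "lat (0, 1) = alpha2"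
  by (simp_all add: vec3_eq_iff)

lemma lat_add: "lat (x + x', y + y') = lat (x, y) + lat (x', y')"
  by (simp add: vec3_eq_iff algebra_simps)

lemma inj_lat: "inj lat"
proof (rule injI)
  fix p q assume "lat p = lat q"
  then show "p = q" by (cases p; cases q) (simp add: vec3_eq_iff)
qed

lemma root_lattice_eq: "root_lattice = range lat"
proof (intro Set.set_eqI iffI)
  fix v assume "v \<in> root_lattice"
  then have "v = lat (v $ 1 + 2 * v $ 3, v $ 3)"
    by (simp add: root_lattice_def sum_3 vec3_eq_iff)
  then show "v \<in> range lat" by blast
next
  fix v assume "v \<in> range lat"
  then obtain x y where "v = lat (x, y)" by auto
  then show "v \<in> root_lattice" by (simp add: root_lattice_def sum_3)
qed

lemma ex_3: "(\<exists>i::3. P i) \<longleftrightarrow> P 1 \<or> P 2 \<or> P 3"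
  using forall_3[of "\<lambda>i. \<not> P i"] by blast

lemma G2_roots_eq: "G2_roots = lat ` root_coords"
proof (intro Set.set_eqI)
  fix v :: "int^3"
  obtain x y z where v: "v $ 1 = x" "v $ 2 = y" "v $ 3 = z" by blast
  have "v \<in> G2_roots \<longleftrightarrow> (\<exists>i j. i \<noteq> j \<and> v = ee i - ee j) \<or>
      (\<exists>i j k. i \<noteq> j \<and> j \<noteq> k \<and> i \<noteq> k \<and>
        (v = ee j + ee k - 2 *s ee i \<or> v = 2 *s ee i - ee j - ee k))"
    unfolding G2_roots_def by (auto split: if_splits)
  also have "\<dots> \<longleftrightarrow> (x, y, z) \<in> {(1,-1,0), (1,0,-1), (-1,1,0), (0,1,-1), (-1,0,1), (0,-1,1),
      (-2,1,1), (2,-1,-1), (1,-2,1), (-1,2,-1), (1,1,-2), (-1,-1,2)}"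
    unfolding vec3_eq_iff v ex_3 by (auto simp: axis_def)
  also have "\<dots> \<longleftrightarrow> v \<in> lat ` root_coords"
    unfolding root_coords_def image_insert image_empty insert_iff empty_iff vec3_eq_iff v
    by auto
  finally show "v \<in> G2_roots \<longleftrightarrow> v \<in> lat ` root_coords" .
qed

lemma cartan_simple:
  "cartan alpha1 alpha1 = 2" "cartan alpha2 alpha1 = -3"
  "cartan alpha1 alpha2 = -1" "cartan alpha2 alpha2 = 2"
  by (simp_all add: cartan_def dot_def sum_3)

text \<open>The letters \<open>True\<close> and \<open>False\<close> stand for \<open>\<alpha>\<^sub>1\<close> and \<open>\<alpha>\<^sub>2\<close>.  If \<open>n\<close> lifts the word
  \<open>b\<^sub>1 \<dots> b\<^sub>k\<close>, then the character \<open>t \<mapsto> \<chi>(n t n\<inverse>)\<close> arises from \<open>\<chi>\<close> by applying the reflection for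
  \<open>b\<^sub>1\<close> first and that for \<open>b\<^sub>k\<close> last, which is why \<open>fold srefl\<close> is the action of a word.\<close>

fun srefl :: "bool \<Rightarrow> int \<times> int \<Rightarrow> int \<times> int" where
  "srefl True (x, y) = (3 * y - x, y)"
| "srefl False (x, y) = (x, x - y)"

text \<open>The alternating words of length at most six, with the one that starts with \<open>\<alpha>\<^sub>1\<close>
  chosen among the two of length six: one reduced word for each of the twelve elements of \<open>W\<close>.\<close>

definition normal_words :: "bool list set" where
  "normal_words = {[], [True], [False], [True, False], [False, True],
    [True, False, True], [False, True, False],
    [True, False, True, False], [False, True, False, True],
    [True, False, True, False, True], [False, True, False, True, False],
    [True, False, True, False, True, False]}"

lemma fold_srefl_linear:
  "fold srefl ws (a * x + b * x', a * y + b * y') =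
    (a * fst (fold srefl ws (x, y)) + b * fst (fold srefl ws (x', y')),
     a * snd (fold srefl ws (x, y)) + b * snd (fold srefl ws (x', y')))"
proof (induction ws arbitrary: x y x' y')
  case (Cons c ws)
  have "srefl c (a * x + b * x', a * y + b * y') =
    (a * fst (srefl c (x, y)) + b * fst (srefl c (x', y')),
     a * snd (srefl c (x, y)) + b * snd (srefl c (x', y')))"
    by (cases c) (simp_all add: algebra_simps)
  then show ?case using Cons by simp
qed simp

lemma fold_srefl_eqI:
  assumes "fold srefl ws (1, 0) = fold srefl vs (1, 0)" "fold srefl ws (0, 1) = fold srefl vs (0, 1)"
  shows "fold srefl ws = fold srefl vs"
proof
  fix p :: "int \<times> int"
  obtain x y where p: "p = (x, y)" by fastforce
  show "fold srefl ws p = fold srefl vs p"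
    using assms fold_srefl_linear[of ws x 1 y 0 0 1] fold_srefl_linear[of vs x 1 y 0 0 1] p by simp
qed

text \<open>A pair with these sums among the roots is a simple system: the string of length four through
  the second root in direction of the first one forces a short and a long root at an angle of 150
  degrees.  There are twelve such pairs, the images of \<open>(\<alpha>\<^sub>1, \<alpha>\<^sub>2)\<close> under the normal words.\<close>

lemma root_string_pairs:
  assumes "(a, b) \<in> root_coords" "(c, d) \<in> root_coords" "(a + c, b + d) \<in> root_coords"
    "(2 * a + c, 2 * b + d) \<in> root_coords" "(3 * a + c, 3 * b + d) \<in> root_coords"
    "(3 * a + 2 * c, 3 * b + 2 * d) \<in> root_coords"
  shows "\<exists>ws\<in>normal_words. fold srefl ws (1, 0) = (a, b) \<and> fold srefl ws (0, 1) = (c, d)"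
proof -
  have "(\<lambda>ws. (fst (fold srefl ws (1, 0)), snd (fold srefl ws (1, 0)), fold srefl ws (0, 1))) ` normal_words =
    {(1, 0, 0, 1),
      (-1, 0, 3, 1),
      (1, 1, 0, -1),
      (-1, -1, 3, 2),
      (2, 1, -3, -1),
      (-2, -1, 3, 2),
      (2, 1, -3, -2),
      (-2, -1, 3, 1),
      (1, 1, -3, -2),
      (-1, -1, 0, 1),
      (1, 0, -3, -1),
      (-1, 0, 0, -1)}" (is "?f ` _ = ?S")
    unfolding normal_words_def image_insert image_empty by simp
  moreover have "(a, b, c, d) \<in> ?S"
    using assms(1,2)[unfolded root_coords_def insert_iff empty_iff prod.inject]
    by (elim disjE conjE FalseE, insert assms(3-6), simp_all add: root_coords_def)
  ultimately have "(a, b, c, d) \<in> ?f ` normal_words" by simp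
  then show ?thesis by force
qed

lemma normal_words_separated:
  assumes "ws \<in> normal_words" "vs \<in> normal_words" "fold srefl ws = fold srefl vs"
  shows "ws = vs"
proof -
  have "fold srefl ws (1, 0) = fold srefl vs (1, 0)" "fold srefl ws (0, 1) = fold srefl vs (0, 1)"
    using assms(3) by simp_all
  moreover have "fold srefl ws (1, 0) = fold srefl vs (1, 0) \<longrightarrow>
      fold srefl ws (0, 1) = fold srefl vs (0, 1) \<longrightarrow> ?thesis"
    using assms(1,2)[unfolded normal_words_def insert_iff empty_iff]
    by (elim disjE; simp)
  ultimately show ?thesis by blast
qed

text \<open>Prepending a letter to a normal word leaves the normal words in three ways: by cancelling
  the first letter, by producing the second word for the longest element, or, from the longest
  normal word, by producing that second word followed by one more letter.\<close>

lemma normal_words_step: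
  assumes "vs \<in> normal_words"
  shows "b # vs \<in> normal_words \<or> (\<exists>us\<in>normal_words. vs = b # us) \<or>
    b # vs = [False, True, False, True, False, True] \<or>
    b # vs = [False, True, False, True, False, True, False]"
  using assms unfolding normal_words_def by (cases b) auto


section \<open>Coordinates on the torus\<close>

locale realized_G2 =
  fixes D :: "('f::field, 'n::finite) datum"
  assumes algebraic: "algebraic_group (gp D)"
    and max_torus: "maximal_torus (tor D) (gp D)"
    and G2: "type_G2 D" and real: "realization D"
begin

abbreviation X :: "int \<times> int \<Rightarrow> 'f^'n^'n \<Rightarrow> 'f" where
  "X p \<equiv> chr D (lat p)"

lemma torus_tor: "torus (tor D)" and tor_subset: "tor D \<subseteq> gp D"
  using max_torus by (auto simp: maximal_torus_def)

lemma subgroup_tor: "subgroup (tor D) GL" and subgroup_gp: "subgroup (gp D) GL"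
  using torus_tor algebraic by (auto simp: torus_def algebraic_group_def)

lemma invertible_gp: "g \<in> gp D \<Longrightarrow> invertible g"
  using subgroup.subset[OF subgroup_gp] by auto

lemma tor_gp: "t \<in> tor D \<Longrightarrow> t \<in> gp D"
  using tor_subset by blast

lemma invertible_tor: "t \<in> tor D \<Longrightarrow> invertible t"
  by (simp add: tor_gp invertible_gp)

lemma tor_mult: "s \<in> tor D \<Longrightarrow> t \<in> tor D \<Longrightarrow> s ** t \<in> tor D"
  using subgroup.m_closed[OF subgroup_tor] by auto

lemma tor_one: "mat 1 \<in> tor D"
  using subgroup.one_closed[OF subgroup_tor] by auto

lemma tor_inv: "t \<in> tor D \<Longrightarrow> matrix_inv t \<in> tor D"
  using subgroup.m_inv_closed[OF subgroup_tor] by (metis inv_GL invertible_tor)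

lemma tor_diagonalizable:
  obtains P where "invertible P" "\<And>t i j. t \<in> tor D \<Longrightarrow> i \<noteq> j \<Longrightarrow> mconj P t $ i $ j = 0"
proof -
  obtain P where "invertible P" "\<forall>t\<in>tor D. \<forall>i j. i \<noteq> j \<longrightarrow> mconj P t $ i $ j = 0"
    using torus_tor unfolding torus_def by (elim conjE exE)
  then show thesis by (intro that) auto
qed

lemma diagonal_mult_entry:
  assumes "\<And>i j. i \<noteq> j \<Longrightarrow> A $ i $ j = 0"
  shows "(A ** B) $ i $ j = A $ i $ i * B $ i $ (j :: 'n)"
proof -
  have "(A ** B) $ i $ j = (\<Sum>k\<in>UNIV. A $ i $ k * B $ k $ j)"
    by (simp add: matrix_matrix_mult_def)
  also have "\<dots> = (\<Sum>k\<in>UNIV. if k = i then A $ i $ i * B $ i $ j else 0)"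
    by (rule sum.cong) (auto simp: assms)
  finally show ?thesis by simp
qed

lemma tor_commute:
  assumes "s \<in> tor D" "t \<in> tor D"
  shows "s ** t = t ** s"
proof -
  obtain P where P: "invertible P" "\<And>t i j. t \<in> tor D \<Longrightarrow> i \<noteq> j \<Longrightarrow> mconj P t $ i $ j = 0"
    using tor_diagonalizable by blast
  have "mconj P s ** mconj P t = mconj P t ** mconj P s"
  proof (unfold vec_eq_iff, intro allI)
    fix i j
    show "(mconj P s ** mconj P t) $ i $ j = (mconj P t ** mconj P s) $ i $ j"
      using diagonal_mult_entry[OF P(2)[OF assms(1)]] diagonal_mult_entry[OF P(2)[OF assms(2)]]
        P(2)[OF assms(1)] P(2)[OF assms(2)]
      by (cases "i = j") (auto simp: mult.commute)
  qed
  then have "mconj P (s ** t) = mconj P (t ** s)" by (simp add: mconj_mult[OF P(1)])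
  then have "P ** (s ** t) = P ** (t ** s)"
    using matrix_right_cancel[OF invertible_matrix_inv[OF P(1)]] by blast
  then show ?thesis by (rule matrix_left_cancel[OF P(1)])
qed

lemma type_G2_facts:
  "chr D ` root_lattice \<subseteq> characters (tor D)"
  "inj_on (chr D) root_lattice"
  "\<forall>v\<in>root_lattice. \<forall>w\<in>root_lattice. \<forall>t\<in>tor D. chr D (v + w) t = chr D v t * chr D w t"
  "chr D ` G2_roots = group_roots (gp D) (tor D)"
  "\<forall>f\<in>characters (tor D). \<exists>k::nat. k > 0 \<and> (\<exists>v\<in>root_lattice. \<forall>t\<in>tor D. f t ^ k = chr D v t)"
  "\<forall>a\<in>G2_roots. cocharacter (tor D) (cor D a) \<and>
     (\<forall>b\<in>G2_roots. \<forall>x. x \<noteq> 0 \<longrightarrow> chr D b (cor D a x) = x powi cartan b a)"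
  using G2 unfolding type_G2_def by - (elim conjE, assumption)+

lemma lat_root_lattice: "lat p \<in> root_lattice"
  by (simp add: root_lattice_eq)

lemma chr_character: "X p \<in> characters (tor D)"
  using type_G2_facts(1) lat_root_lattice by blast

lemma chr_nonzero [simp]: "t \<in> tor D \<Longrightarrow> X p t \<noteq> 0"
  and chr_mult: "s \<in> tor D \<Longrightarrow> t \<in> tor D \<Longrightarrow> X p (s ** t) = X p s * X p t"
  and chr_regular: "regular_on (tor D) (X p)"
  using chr_character[of p] unfolding characters_def by auto

lemma chr_add: "t \<in> tor D \<Longrightarrow> X (x + x', y + y') t = X (x, y) t * X (x', y') t"
  unfolding lat_add using type_G2_facts(3) lat_root_lattice by blast

lemma chr_zero: "t \<in> tor D \<Longrightarrow> X (0, 0) t = 1"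
  using chr_add[of t 0 0 0 0] by simp

lemma chr_uminus: "t \<in> tor D \<Longrightarrow> X (- x, - y) t = inverse (X (x, y) t)"
  using chr_add[of t x "- x" y "- y"] chr_zero[of t] by (simp add: inverse_unique)

lemma chr_of_nat:
  "t \<in> tor D \<Longrightarrow> X (int n * x, int n * y) t = X (x, y) t ^ n"
  by (induction n) (simp_all add: chr_zero chr_add algebra_simps)

lemma chr_of_int: "t \<in> tor D \<Longrightarrow> X (k * x, k * y) t = X (x, y) t powi k"
proof (cases "k \<ge> 0")
  case True
  assume "t \<in> tor D"
  then show ?thesis using chr_of_nat[of t "nat k" x y] True by (simp add: power_int_def)
next
  case False
  assume "t \<in> tor D"
  then show ?thesis using chr_of_nat[of t "nat (- k)" "- x" "- y"] False
    by (simp add: power_int_def chr_uminus power_inverse)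
qed

lemma chr_simple: "t \<in> tor D \<Longrightarrow> X (x, y) t = X (1, 0) t powi x * X (0, 1) t powi y"
  using chr_add[of t x 0 0 y] chr_of_int[of t x 1 0] chr_of_int[of t y 0 1] by simp

lemma inj_chr: "inj X"
proof (rule injI)
  fix p q assume "X p = X q"
  then have "lat p = lat q"
    using type_G2_facts(2) lat_root_lattice by (simp add: inj_on_def)
  then show "p = q" by (rule injD[OF inj_lat])
qed

lemma chr_eqD:
  assumes "\<And>t. t \<in> tor D \<Longrightarrow> X p t = X q t"
  shows "p = q"
proof -
  have "X p = X q"
    using chr_character[of p] chr_character[of q] assms
    unfolding characters_def by (auto intro: extensionalityI)
  then show ?thesis by (rule injD[OF inj_chr])
qed

lemma alpha_roots: "alpha1 \<in> G2_roots" "alpha2 \<in> G2_roots"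
  unfolding G2_roots_eq lat_simple[symmetric] by (auto simp: root_coords_def)

lemma cor_cocharacter:
  assumes "a \<in> {alpha1, alpha2}"
  shows "cocharacter (tor D) (cor D a)"
  using type_G2_facts(6) alpha_roots assms by auto

lemma cor_tor: "a \<in> {alpha1, alpha2} \<Longrightarrow> x \<noteq> 0 \<Longrightarrow> cor D a x \<in> tor D"
  and cor_mult: "a \<in> {alpha1, alpha2} \<Longrightarrow> x \<noteq> 0 \<Longrightarrow> y \<noteq> 0 \<Longrightarrow>
    cor D a (x * y) = cor D a x ** cor D a y"
  using cor_cocharacter[of a] unfolding cocharacter_def by blast+

lemma cor_one: "a \<in> {alpha1, alpha2} \<Longrightarrow> cor D a 1 = mat 1"
  using cor_mult[of a 1 1] cor_tor[of a 1] invertible_tor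
  by (metis matrix_left_cancel matrix_mul_rid mult_1 zero_neq_one)

lemma chr_cor:
  assumes "x \<noteq> 0"
  shows "X (1, 0) (cor D alpha1 x) = x\<^sup>2" "X (0, 1) (cor D alpha1 x) = inverse (x ^ 3)"
    "X (1, 0) (cor D alpha2 x) = inverse x" "X (0, 1) (cor D alpha2 x) = x\<^sup>2"
proof -
  have *: "chr D b (cor D a x) = x powi cartan b a"
    if "a \<in> {alpha1, alpha2}" "b \<in> {alpha1, alpha2}" for a b
    using type_G2_facts(6) alpha_roots assms that by auto
  show "X (1, 0) (cor D alpha1 x) = x\<^sup>2" "X (0, 1) (cor D alpha1 x) = inverse (x ^ 3)"
    "X (1, 0) (cor D alpha2 x) = inverse x" "X (0, 1) (cor D alpha2 x) = x\<^sup>2"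
    by (simp_all add: lat_simple * cartan_simple power_int_def power_inverse)
qed

lemma coord_tor: "x \<noteq> 0 \<Longrightarrow> y \<noteq> 0 \<Longrightarrow> coord D x y \<in> tor D"
  by (simp add: coord_def tor_mult cor_tor)

lemma chr_coord:
  assumes "x \<noteq> 0" "y \<noteq> 0"
  shows "X (1, 0) (coord D x y) = x\<^sup>2 / y" "X (0, 1) (coord D x y) = y\<^sup>2 / x ^ 3"
  using assms by (simp_all add: coord_def chr_mult cor_tor chr_cor divide_simps)

lemma coord_mult:
  assumes "x \<noteq> 0" "y \<noteq> 0" "x' \<noteq> 0" "y' \<noteq> 0"
  shows "coord D x y ** coord D x' y' = coord D (x * x') (y * y')"
proof -
  have "coord D x y ** coord D x' y' =
      cor D alpha1 x ** (cor D alpha2 y ** cor D alpha1 x') ** cor D alpha2 y'"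
    by (simp add: coord_def matrix_mul_assoc)
  also have "cor D alpha2 y ** cor D alpha1 x' = cor D alpha1 x' ** cor D alpha2 y"
    using assms by (intro tor_commute cor_tor) auto
  finally show ?thesis using assms by (simp add: coord_def cor_mult matrix_mul_assoc)
qed

lemma coord_one: "coord D 1 1 = mat 1"
  by (simp add: coord_def cor_one)

lemma regular_cor_chr: "a \<in> {alpha1, alpha2} \<Longrightarrow> regular_on (tor D) (\<lambda>t. cor D a (X (x, y) t) $ i $ j)"
proof -
  assume a: "a \<in> {alpha1, alpha2}"
  then obtain p k where p: "\<And>x. x \<noteq> 0 \<Longrightarrow> cor D a x $ i $ j = poly p x / x ^ k"
    using cor_cocharacter[OF a] unfolding cocharacter_def by metis
  have "regular_on (tor D) (\<lambda>t. poly p (X (x, y) t) * X (- x, - y) t ^ k)"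
    by (rule regular_on_mult[OF regular_on_poly[OF invertible_tor chr_regular] regular_on_power[OF chr_regular]])
  then show ?thesis
    by (rule regular_on_cong[THEN iffD1, rotated]) (simp add: p chr_uminus power_inverse divide_inverse)
qed

text \<open>The roots of \<open>G\<^sub>2\<close> generate the full character lattice, because the coroots pair perfectly
  with the root lattice.  Concretely, \<open>t\<close> times the inverse of the element with coordinates
  \<open>(2\<alpha>\<^sub>1 + \<alpha>\<^sub>2)(t)\<close> and \<open>(3\<alpha>\<^sub>1 + 2\<alpha>\<^sub>2)(t)\<close> is killed by all roots, so its diagonal entries are roots
  of unity of bounded order.  As \<open>T\<close> is connected, they are constant as \<open>t\<close> varies, hence \<open>1\<close>.\<close>

lemma tor_eq_coord:
  assumes t: "t \<in> tor D"
  shows "t = coord D (X (2, 1) t) (X (3, 2) t)"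
proof -
  (* Inverses are written as values of negated characters, which makes the entries of q regular. *)
  define q where
    "q t = t ** cor D alpha1 (X (- 2, - 1) t) ** cor D alpha2 (X (- 3, - 2) t)" for t
  have q_tor: "q t \<in> tor D" if "t \<in> tor D" for t
    unfolding q_def using that by (intro tor_mult cor_tor) auto
  have q_simple: "X (1, 0) (q t) = 1" "X (0, 1) (q t) = 1" if "t \<in> tor D" for t
  proof -
    let ?u = "X (- 2, - 1) t" and ?w = "X (- 3, - 2) t"
    have nz: "?u \<noteq> 0" "?w \<noteq> 0" using that by auto
    have "X (1, 0) (q t) = X (1, 0) t * ?u\<^sup>2 * inverse ?w"
      "X (0, 1) (q t) = X (0, 1) t * inverse (?u ^ 3) * ?w\<^sup>2"
      using that nz by (simp_all add: q_def chr_mult cor_tor tor_mult chr_cor)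
    then show "X (1, 0) (q t) = 1" "X (0, 1) (q t) = 1"
      using that chr_simple[of t "- 2" "- 1"] chr_simple[of t "- 3" "- 2"]
      by (simp_all add: power_int_def power_inverse field_simps power_mult_distrib
          power_mult[symmetric] eval_nat_numeral)
  qed
  have q_chr: "X p (q t) = 1" if "t \<in> tor D" for t p
    using chr_simple[OF q_tor[OF that], of "fst p" "snd p"] q_simple[OF that] by simp
  obtain P where P: "invertible P" "\<And>t i j. t \<in> tor D \<Longrightarrow> i \<noteq> j \<Longrightarrow> mconj P t $ i $ j = 0"
    using tor_diagonalizable by blast
  have one: "mconj P (mat 1) = mat 1" by (simp add: matrix_inv_inverts P)
  have "mconj P (q t) $ i $ i = 1" for i
  proof -
    let ?f = "\<lambda>t. mconj P t $ i $ i"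
    have f_mult: "?f (r ** s) = ?f r * ?f s" if "r \<in> tor D" "s \<in> tor D" for r s
      using diagonal_mult_entry[OF P(2)[OF that(1)]] by (simp add: mconj_mult[OF P(1)])
    have f_nz: "?f s \<noteq> 0" if "s \<in> tor D" for s
      using f_mult[OF that tor_inv[OF that]] one matrix_inv_inverts(1)[OF invertible_tor[OF that]]
      by (auto simp: mat_def)
    have "restrict ?f (tor D) \<in> characters (tor D)"
      unfolding characters_def using f_mult f_nz
      by (auto simp: tor_mult intro!: regular_on_cong[THEN iffD1, OF _ regular_on_polyfun[OF polyfun_mconj_entry]])
    then obtain k v where k: "k > 0" "v \<in> root_lattice" "\<forall>t\<in>tor D. restrict ?f (tor D) t ^ k = chr D v t"
      using type_G2_facts(5) by blast
    obtain p where "v = lat p" using k(2) by (auto simp: root_lattice_eq)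
    then have unity: "?f (q s) ^ k = 1" if "s \<in> tor D" for s
      using k(3) q_tor[OF that] q_chr[OF that] by simp
    have "regular_on (tor D) (\<lambda>t. ?f (q t))"
      unfolding q_def
      by (intro regular_on_mult_entry invertible_tor regular_cor_chr
          regular_on_polyfun[OF polyfun.const] regular_on_polyfun[OF polyfun.entry]) auto
    moreover have "finite ((\<lambda>t. ?f (q t)) ` tor D)"
      by (rule finite_subset[OF _ finite_roots_of_unity[OF k(1)]]) (auto simp: unity)
    ultimately have "?f (q t) = ?f (q (mat 1))"
      using torus_tor t tor_one
      by (intro connected_finite_image_constant[of "tor D" "\<lambda>t. ?f (q t)"])
        (auto simp: torus_def algebraic_group_def)
    moreover have "X p (mat 1) = 1" for p
      using chr_mult[OF tor_one tor_one, of p] chr_nonzero[OF tor_one, of p] by simp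
    then have "q (mat 1) = mat 1" by (simp add: q_def cor_one)
    ultimately show ?thesis using one by (simp add: mat_def)
  qed
  then have "mconj P (q t) = mat 1"
    using P(2)[OF q_tor[OF t]] by (simp add: vec_eq_iff mat_def)
  then have "P ** q t = P ** mat 1" by (simp add: mconj_eq_iff[OF P(1)])
  then have q1: "q t = mat 1" by (rule matrix_left_cancel[OF P(1)])
  let ?c = "coord D (X (- 2, - 1) t) (X (- 3, - 2) t)"
  have "q t = t ** ?c" by (simp add: q_def coord_def matrix_mul_assoc)
  then have "t ** ?c = mat 1" using q1 by simp
  moreover have "coord D (X (2, 1) t) (X (3, 2) t) ** ?c = mat 1"
    using t chr_uminus[of t 2 1] chr_uminus[of t 3 2] by (simp add: coord_mult coord_one)
  moreover have "invertible ?c" using t by (intro invertible_tor coord_tor) auto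
  ultimately show ?thesis using matrix_right_cancel by metis
qed

lemma tor_coord_cases:
  assumes "t \<in> tor D"
  obtains x y where "x \<noteq> 0" "y \<noteq> 0" "t = coord D x y"
  using tor_eq_coord[OF assms] assms by (metis chr_nonzero)

lemma tor_eqI:
  assumes "s \<in> tor D" "t \<in> tor D" "X (1, 0) s = X (1, 0) t" "X (0, 1) s = X (0, 1) t"
  shows "s = t"
proof -
  have "X (x, y) s = X (x, y) t" for x y
    by (simp only: chr_simple[OF assms(1), of x y] chr_simple[OF assms(2), of x y] assms(3,4))
  then have "coord D (X (2, 1) s) (X (3, 2) s) = coord D (X (2, 1) t) (X (3, 2) t)" by simp
  then show ?thesis using tor_eq_coord assms(1,2) by metis
qed

lemma coord_eq_iff:
  assumes "x \<noteq> 0" "y \<noteq> 0" "x' \<noteq> 0" "y' \<noteq> 0"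
  shows "coord D x y = coord D x' y' \<longleftrightarrow> x = x' \<and> y = y'"
proof -
  have *: "X (2, 1) (coord D x y) = x" "X (3, 2) (coord D x y) = y" if "x \<noteq> 0" "y \<noteq> 0" for x y
    unfolding chr_simple[OF coord_tor[OF that], of 2 1] chr_simple[OF coord_tor[OF that], of 3 2]
    using that by (simp_all add: chr_coord power_int_def field_simps eval_nat_numeral)
  show ?thesis using *[OF assms(1,2)] *[OF assms(3,4)] by metis
qed

lemma coord_eq_one_iff: "x \<noteq> 0 \<Longrightarrow> y \<noteq> 0 \<Longrightarrow> coord D x y = mat 1 \<longleftrightarrow> x = 1 \<and> y = 1"
  using coord_eq_iff[of x y 1 1] by (simp add: coord_one)

section \<open>The action of the normalizer\<close>


lemma nrm_iff: "n \<in> nrm D \<longleftrightarrow> n \<in> gp D \<and> mconj n ` tor D = tor D"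
proof -
  have "(n <#\<^bsub>grp (gp D)\<^esub> tor D) #>\<^bsub>grp (gp D)\<^esub> inv\<^bsub>grp (gp D)\<^esub> n = mconj n ` tor D"
    if "n \<in> gp D"
    using that group.m_inv_consistent[OF group_GL subgroup_gp that]
    by (auto simp: l_coset_def r_coset_def inv_GL invertible_gp)
  then show ?thesis
    using tor_subset unfolding nrm_def normalizer_def stabilizer_def by auto
qed

lemma nrm_gp: "n \<in> nrm D \<Longrightarrow> n \<in> gp D"
  by (simp add: nrm_iff)

lemma invertible_nrm: "n \<in> nrm D \<Longrightarrow> invertible n"
  by (simp add: nrm_gp invertible_gp)

lemma nrm_conj_tor: "n \<in> nrm D \<Longrightarrow> t \<in> tor D \<Longrightarrow> mconj n t \<in> tor D"
  using nrm_iff by blast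

lemma mconj_tor:
  assumes "s \<in> tor D" "t \<in> tor D"
  shows "mconj s t = t"
  using mconj_eq_iff[OF invertible_tor[OF assms(1)]] tor_commute[OF assms] by blast

lemma tor_nrm: "t \<in> tor D \<Longrightarrow> t \<in> nrm D"
  unfolding nrm_iff by (simp add: tor_gp mconj_tor)

lemma nrm_mult:
  assumes "m \<in> nrm D" "n \<in> nrm D"
  shows "m ** n \<in> nrm D"
proof -
  have "mconj (m ** n) ` tor D = mconj m ` mconj n ` tor D"
    unfolding image_image mconj_mconj[OF invertible_nrm invertible_nrm, OF assms] ..
  moreover have "m ** n \<in> gp D"
    using subgroup.m_closed[OF subgroup_gp] assms nrm_gp by auto
  ultimately show ?thesis using assms unfolding nrm_iff by simp
qed

lemma nrm_inv:
  assumes "n \<in> nrm D"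
  shows "matrix_inv n \<in> nrm D"
proof -
  have n: "invertible n" using assms by (rule invertible_nrm)
  have "mconj (matrix_inv n) ` mconj n ` tor D = (\<lambda>t. t) ` tor D"
    unfolding image_image mconj_mconj[OF invertible_matrix_inv[OF n] n] matrix_inv_inverts[OF n]
    by (rule image_cong) (simp_all only: mconj_tor tor_one)
  moreover have "matrix_inv n \<in> gp D"
    using subgroup.m_inv_closed[OF subgroup_gp] nrm_gp[OF assms] inv_GL[OF n] by metis
  ultimately show ?thesis using assms unfolding nrm_iff by simp
qed

text \<open>Conjugation by an element of the group is a linear substitution that maps the line
  \<open>1 + eY\<close> to the line through the conjugate of \<open>Y\<close> and preserves the equations of the group.\<close>

lemma lie_algebra_mconj:
  assumes Y: "Y \<in> lie_algebra (gp D)" and n: "n \<in> gp D"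
  shows "mconj n Y \<in> lie_algebra (gp D)"
  unfolding lie_algebra_def
proof (intro CollectI ballI impI)
  fix p :: "'f^'n^'n \<Rightarrow> 'f" assume p: "p \<in> polyfun" "\<forall>A\<in>gp D. p A = 0"
  have inv: "invertible n" using n by (rule invertible_gp)
  have "(\<lambda>A. p (mconj n A)) \<in> polyfun"
    by (rule polyfun_compose[OF p(1) polyfun_mconj_entry])
  from bspec[OF CollectD[OF Y[unfolded lie_algebra_def]] this]
  have tangent: "(\<forall>A\<in>gp D. p (mconj n A) = 0) \<longrightarrow>
      (\<exists>q. \<forall>e. p (mconj n (mat 1 + mat e ** Y)) = e ^ 2 * poly q e)" .
  have "mconj n A \<in> gp D" if "A \<in> gp D" for A
    using subgroup.m_closed[OF subgroup_gp] subgroup.m_inv_closed[OF subgroup_gp n] that n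
    by (auto simp: inv_GL inv)
  then obtain q where q: "\<forall>e. p (mconj n (mat 1 + mat e ** Y)) = e ^ 2 * poly q e"
    using tangent p(2) by blast
  have "mconj n (mat 1 + mat e ** Y) = mat 1 + mat e ** mconj n Y" for e
    by (simp only: mconj_add mconj_scalar) (simp add: matrix_inv_inverts inv)
  with q show "\<exists>q. \<forall>e. p (mat 1 + mat e ** mconj n Y) = e ^ 2 * poly q e" by auto
qed

text \<open>The normalizer acts on the Lie algebra and moves the root space of \<open>a\<close> to that of the
  conjugated character, so it permutes the roots.\<close>

lemma nrm_permutes_roots:
  assumes n: "n \<in> nrm D" and r: "r \<in> root_coords"
  shows "\<exists>r'\<in>root_coords. \<forall>t\<in>tor D. X r (mconj n t) = X r' t"
proof -
  have inv: "invertible n" and inv': "invertible (matrix_inv n)"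
    using n invertible_nrm invertible_matrix_inv by blast+
  have "X r \<in> group_roots (gp D) (tor D)"
    using r type_G2_facts(4) G2_roots_eq by blast
  then obtain Y where Y: "Y \<in> lie_algebra (gp D)" "Y \<noteq> 0"
      "\<And>t. t \<in> tor D \<Longrightarrow> mconj t Y = mat (X r t) ** Y"
    and nontriv: "\<exists>t\<in>tor D. X r t \<noteq> 1"
    unfolding group_roots_def by blast
  define f where "f = restrict (\<lambda>t. X r (mconj n t)) (tor D)"
  have f: "f t = X r (mconj n t)" if "t \<in> tor D" for t
    using that by (simp add: f_def)
  have "f \<in> characters (tor D)"
    unfolding characters_def
  proof (intro CollectI conjI ballI)
    show "f \<in> extensional (tor D)" by (simp add: f_def)
    show "regular_on (tor D) f"
      using regular_on_mconj[OF chr_regular inv nrm_conj_tor[OF n], of r]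
      by (subst regular_on_cong[OF f])
    fix s t assume st: "s \<in> tor D" "t \<in> tor D"
    show "f s \<noteq> 0" using st f chr_nonzero[OF nrm_conj_tor[OF n]] by metis
    show "f (s ** t) = f s * f t"
      using st by (simp only: f tor_mult mconj_mult[OF inv] chr_mult nrm_conj_tor[OF n])
  qed
  moreover have "\<exists>t\<in>tor D. f t \<noteq> 1"
  proof -
    obtain s where s: "s \<in> tor D" "X r s \<noteq> 1" using nontriv by blast
    then obtain t where "t \<in> tor D" "s = mconj n t" using n unfolding nrm_iff by blast
    with s show ?thesis using f by metis
  qed
  moreover have "\<exists>Y'\<in>lie_algebra (gp D). Y' \<noteq> 0 \<and> (\<forall>t\<in>tor D. mconj t Y' = mat (f t) ** Y')"
  proof (intro bexI conjI ballI)
    show "mconj (matrix_inv n) Y \<in> lie_algebra (gp D)"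
      by (intro lie_algebra_mconj Y nrm_gp nrm_inv n)
    have cancel: "mconj n (mconj (matrix_inv n) C) = C" for C
      by (simp only: mconj_mconj[OF inv inv'] matrix_inv_inverts[OF inv] mconj_one)
    show "mconj (matrix_inv n) Y \<noteq> 0"
      using cancel[of Y] Y(2) by auto
    fix t assume t: "t \<in> tor D"
    let ?Y = "mconj (matrix_inv n) Y"
    have "mconj n t ** Y = mat (X r (mconj n t)) ** Y ** mconj n t"
      using Y(3)[OF nrm_conj_tor[OF n t]]
        mconj_eq_iff[OF invertible_tor[OF nrm_conj_tor[OF n t]]] by blast
    then have "mconj n t ** mconj n ?Y = mat (f t) ** mconj n ?Y ** mconj n t"
      using t by (simp only: cancel f)
    moreover have "mat (f t) ** mconj n ?Y = mconj n (mat (f t) ** ?Y)"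
      by (rule mconj_scalar[symmetric])
    ultimately have "mconj n (t ** ?Y) = mconj n (mat (f t) ** ?Y ** t)"
      by (simp only: mconj_mult[OF inv])
    then have "n ** (t ** ?Y) = n ** (mat (f t) ** ?Y ** t)"
      using matrix_right_cancel[OF inv'] by blast
    then have "t ** ?Y = mat (f t) ** ?Y ** t" by (rule matrix_left_cancel[OF inv])
    then show "mconj t ?Y = mat (f t) ** ?Y" using mconj_eq_iff[OF invertible_tor[OF t]] by blast
  qed
  ultimately have "f \<in> group_roots (gp D) (tor D)" unfolding group_roots_def by blast
  then obtain r' where "r' \<in> root_coords" "f = X r'"
    using type_G2_facts(4) G2_roots_eq by (metis (no_types, lifting) imageE)
  with f show ?thesis by metis
qed

text \<open>The map induced on the roots is additive, so it is determined by the images of the simple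
  roots, which form one of the pairs found in \<open>root_string_pairs\<close>.\<close>

lemma nrm_acts_as_word:
  assumes n: "n \<in> nrm D"
  shows "\<exists>ws\<in>normal_words. \<forall>t\<in>tor D. \<forall>p. X p (mconj n t) = X (fold srefl ws p) t"
proof -
  have simple: "(1, 0) \<in> root_coords" "(0, 1) \<in> root_coords" by (simp_all add: root_coords_def)
  obtain r where r: "r \<in> root_coords" "\<forall>t\<in>tor D. X (1, 0) (mconj n t) = X r t"
    using nrm_permutes_roots[OF n simple(1)] ..
  obtain r' where r': "r' \<in> root_coords" "\<forall>t\<in>tor D. X (0, 1) (mconj n t) = X r' t"
    using nrm_permutes_roots[OF n simple(2)] ..
  obtain a b c d where abcd: "r = (a, b)" "r' = (c, d)" by fastforce
  note ab = r[unfolded abcd] and cd = r'[unfolded abcd]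
  have lin: "X (x, y) (mconj n t) = X (x * a + y * c, x * b + y * d) t" if "t \<in> tor D" for x y t
    using that chr_simple[OF nrm_conj_tor[OF n that], of x y]
    by (simp add: ab cd chr_add chr_of_int)
  have root: "(x * a + y * c, x * b + y * d) \<in> root_coords" if xy: "(x, y) \<in> root_coords" for x y
  proof -
    obtain r where "r \<in> root_coords" "\<forall>t\<in>tor D. X (x, y) (mconj n t) = X r t"
      using nrm_permutes_roots[OF n xy] by blast
    then show ?thesis using chr_eqD lin by metis
  qed
  have mem: "(1, 1) \<in> root_coords" "(2, 1) \<in> root_coords" "(3, 1) \<in> root_coords"
    "(3, 2) \<in> root_coords" by (simp_all add: root_coords_def)
  obtain ws where ws: "ws \<in> normal_words" "fold srefl ws (1, 0) = (a, b)" "fold srefl ws (0, 1) = (c, d)"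
    using root_string_pairs[OF ab(1) cd(1)] root[OF mem(1)] root[OF mem(2)] root[OF mem(3)]
      root[OF mem(4)] unfolding mult_1 by blast
  have "fold srefl ws (x, y) = (x * a + y * c, x * b + y * d)" for x y
    using fold_srefl_linear[of ws x 1 y 0 0 1] ws(2,3) by simp
  then have "X p (mconj n t) = X (fold srefl ws p) t" if "t \<in> tor D" for p t
    using lin[OF that, of "fst p" "snd p"] by (cases p) simp
  with ws(1) show ?thesis by blast
qed


section \<open>Lifts of words in the simple reflections\<close>

abbreviation root :: "bool \<Rightarrow> int^3" where
  "root b \<equiv> if b then alpha1 else alpha2"

abbreviation refl_coset :: "bool \<Rightarrow> ('f^'n^'n) set" where
  "refl_coset b \<equiv> reflection D (root b)"

lemma realization_facts:
  assumes "a \<in> {alpha1, alpha2}"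
  shows "sigma_lift D a \<in> nrm D" "weyl_proj D (sigma_lift D a) = reflection D a"
    "\<And>x. x \<noteq> 0 \<Longrightarrow> ru D a x ** ru D (- a) (- inverse x) ** ru D a x = cor D a x ** sigma_lift D a"
    "\<And>x y. ru D a (x + y) = ru D a x ** ru D a y"
    "ru D a x \<in> gp D"
proof -
  have a: "a \<in> G2_roots" using assms alpha_roots by auto
  have 1: "additive_embedding (gp D) (ru D a) \<and>
     (\<forall>t\<in>tor D. \<forall>x. mconj t (ru D a x) = ru D a (chr D a t * x)) \<and>
     sigma_lift D a \<in> nrm D \<and> weyl_proj D (sigma_lift D a) = reflection D a \<and>
     (\<forall>x. x \<noteq> 0 \<longrightarrow>
        ru D a x ** ru D (- a) (- inverse x) ** ru D a x = cor D a x ** sigma_lift D a)"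
    using real a unfolding realization_def by (rule bspec)
  then show "sigma_lift D a \<in> nrm D" "weyl_proj D (sigma_lift D a) = reflection D a"
    "\<And>x. x \<noteq> 0 \<Longrightarrow> ru D a x ** ru D (- a) (- inverse x) ** ru D a x = cor D a x ** sigma_lift D a"
    by simp_all
  have "additive_embedding (gp D) (ru D a)" using 1 by simp
  then show "\<And>x y. ru D a (x + y) = ru D a x ** ru D a y" "ru D a x \<in> gp D"
    unfolding additive_embedding_def by auto
qed

lemma weyl_proj_eq: "weyl_proj D n = {t ** n |t. t \<in> tor D}"
  unfolding weyl_proj_def r_coset_def by auto

lemma refl_coset_iff: "n \<in> refl_coset b \<longleftrightarrow> (\<exists>t\<in>tor D. n = t ** sigma_lift D (root b))"
proof -
  have "root b \<in> {alpha1, alpha2}" by simp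
  from realization_facts(2)[OF this, symmetric] show ?thesis unfolding weyl_proj_eq by blast
qed

lemma refl_coset_nrm: "n \<in> refl_coset b \<Longrightarrow> n \<in> nrm D"
  by (simp add: reflection_def)

lemma sigma_refl_coset: "sigma_lift D (root b) \<in> refl_coset b"
  unfolding refl_coset_iff using tor_one by (intro bexI[of _ "mat 1"]) auto

lemma refl_coset_coord:
  assumes n: "n \<in> refl_coset b" and xy: "x \<noteq> 0" "y \<noteq> 0"
  shows "n ** coord D x y = (if b then coord D (y / x) y else coord D x (x ^ 3 / y)) ** n"
proof -
  have "mconj n (coord D x y) =
      coord D x y ** cor D (root b) (inverse (chr D (root b) (coord D x y)))"
    using n coord_tor[OF xy] by (simp add: reflection_def)
  also have "\<dots> = coord D x y ** (if b then coord D (y / x\<^sup>2) 1 else coord D 1 (x ^ 3 / y\<^sup>2))"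
    using chr_coord[OF xy] by (simp add: lat_simple coord_def cor_one)
  also have "\<dots> = (if b then coord D (y / x) y else coord D x (x ^ 3 / y))"
    using xy by (simp add: coord_mult power2_eq_square)
  finally show ?thesis using mconj_eq_iff[OF invertible_nrm[OF refl_coset_nrm[OF n]]] by blast
qed

lemma chr_refl_coset:
  assumes n: "n \<in> refl_coset b" and t: "t \<in> tor D"
  shows "X p (mconj n t) = X (srefl b p) t"
proof -
  obtain x y where t_eq: "x \<noteq> 0" "y \<noteq> 0" "t = coord D x y" using tor_coord_cases[OF t] .
  obtain k m where p: "p = (k, m)" by fastforce
  have s: "mconj n t \<in> tor D" using nrm_conj_tor[OF refl_coset_nrm[OF n] t] .
  have nt: "mconj n t = (if b then coord D (y / x) y else coord D x (x ^ 3 / y))"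
    unfolding t_eq(3) mconj_eq_iff[OF invertible_nrm[OF refl_coset_nrm[OF n]]]
    by (rule refl_coset_coord[OF n t_eq(1,2)])
  have 1: "X (1, 0) (mconj n t) = X (srefl b (1, 0)) t \<and> X (0, 1) (mconj n t) = X (srefl b (0, 1)) t"
    using nt chr_simple[OF t] t_eq
    by (cases b) (simp_all add: chr_coord power_int_def field_simps eval_nat_numeral)
  have "srefl b (k, m) = (k * fst (srefl b (1, 0)) + m * fst (srefl b (0, 1)),
      k * snd (srefl b (1, 0)) + m * snd (srefl b (0, 1)))"
    by (cases b) auto
  then show ?thesis unfolding p
    using chr_simple[OF s, of k m] 1 t by (simp add: chr_add chr_of_int del: srefl.simps)
qed

text \<open>Multiplying \<open>\<sigma>\<^sub>\<alpha>\<close> by an element \<open>z\<close> that centralizes \<open>T\<close> gives another element acting as the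
  reflection, and the elements of \<open>N\<close> that do so form the single coset \<open>T \<sigma>\<^sub>\<alpha>\<close>.\<close>

lemma centralizer_tor:
  assumes z: "z \<in> nrm D" "\<And>t. t \<in> tor D \<Longrightarrow> mconj z t = t"
  shows "z \<in> tor D"
proof -
  let ?s = "sigma_lift D (root True)"
  have s: "?s \<in> refl_coset True" "?s \<in> nrm D"
    using sigma_refl_coset refl_coset_nrm by blast+
  have "mconj (z ** ?s) t = mconj ?s t" if "t \<in> tor D" for t
    using z(2)[OF nrm_conj_tor[OF s(2) that]]
    by (simp only: mconj_mconj[OF invertible_nrm[OF z(1)] invertible_nrm[OF s(2)], symmetric])
  then have "z ** ?s \<in> refl_coset True"
    using s nrm_mult[OF z(1) s(2)] by (simp add: reflection_def)
  then obtain t where "t \<in> tor D" "z ** ?s = t ** ?s" unfolding refl_coset_iff by blast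
  then show ?thesis using matrix_right_cancel[OF invertible_nrm[OF s(2)]] by blast
qed

text \<open>Characters in the root lattice separate the points of \<open>T\<close>, so elements that act equally on
  these characters differ by an element centralizing \<open>T\<close>.\<close>

lemma nrm_coset_eq:
  assumes m: "m \<in> nrm D" and n: "n \<in> nrm D"
    and eq: "\<And>t p. t \<in> tor D \<Longrightarrow> X p (mconj m t) = X p (mconj n t)"
  shows "\<exists>t\<in>tor D. m = t ** n"
proof
  have same: "mconj m t = mconj n t" if "t \<in> tor D" for t
    by (intro tor_eqI nrm_conj_tor m n that eq)
  have n': "matrix_inv n \<in> nrm D" using n by (rule nrm_inv)
  have "mconj (m ** matrix_inv n) t = t" if t: "t \<in> tor D" for t
  proof -
    have "mconj (m ** matrix_inv n) t = mconj m (mconj (matrix_inv n) t)"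
      by (rule mconj_mconj[OF invertible_nrm[OF m] invertible_nrm[OF n'], symmetric])
    also have "\<dots> = mconj n (mconj (matrix_inv n) t)"
      by (rule same[OF nrm_conj_tor[OF n' t]])
    also have "\<dots> = mconj (n ** matrix_inv n) t"
      by (rule mconj_mconj[OF invertible_nrm[OF n] invertible_nrm[OF n']])
    finally show ?thesis
      by (simp only: matrix_inv_inverts[OF invertible_nrm[OF n]] mconj_tor[OF tor_one t])
  qed
  then show "m ** matrix_inv n \<in> tor D" by (intro centralizer_tor nrm_mult m n')
  show "m = m ** matrix_inv n ** n"
    by (simp add: matrix_mul_assoc[symmetric] matrix_inv_inverts[OF invertible_nrm[OF n]])
qed

text \<open>The definition has the shape in which products along words occur in the definition of a section.\<close>

definition lift :: "(bool \<Rightarrow> 'f^'n^'n) \<Rightarrow> bool list \<Rightarrow> 'f^'n^'n" where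
  "lift L ws = foldr (**) (map L ws) (mat 1)"

lemma lift_simps [simp]: "lift L [] = mat 1" "lift L (b # ws) = L b ** lift L ws"
  by (simp_all add: lift_def)

lemma lift_append: "lift L (ws @ vs) = lift L ws ** lift L vs"
  by (induction ws) (simp_all add: matrix_mul_assoc)

context
  fixes L assumes L: "\<And>b. L b \<in> refl_coset b"
begin

lemma lift_nrm: "lift L ws \<in> nrm D"
  by (induction ws) (auto intro: nrm_mult refl_coset_nrm L tor_nrm tor_one)

lemma chr_lift: "t \<in> tor D \<Longrightarrow> X p (mconj (lift L ws) t) = X (fold srefl ws p) t"
proof (induction ws arbitrary: p)
  case Nil
  then show ?case by (simp only: lift_simps mconj_tor tor_one fold_simps)
next
  case (Cons b ws)
  have "mconj (lift L (b # ws)) t = mconj (L b) (mconj (lift L ws) t)"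
    unfolding lift_simps
    by (rule mconj_mconj[OF invertible_nrm[OF refl_coset_nrm[OF L]] invertible_nrm[OF lift_nrm], symmetric])
  then have "X p (mconj (lift L (b # ws)) t) = X (srefl b p) (mconj (lift L ws) t)"
    by (simp only: chr_refl_coset[OF L nrm_conj_tor[OF lift_nrm Cons.prems]])
  with Cons show ?case by simp
qed

end

lemma lift_coset_iff:
  assumes L: "\<And>b. L b \<in> refl_coset b" and M: "\<And>b. M b \<in> refl_coset b"
  shows "(\<exists>t\<in>tor D. lift L ws = t ** lift M vs) \<longleftrightarrow> fold srefl ws = fold srefl vs"
proof
  assume "\<exists>t\<in>tor D. lift L ws = t ** lift M vs"
  then obtain t where t: "t \<in> tor D" "lift L ws = t ** lift M vs" by blast
  have "X (fold srefl ws p) s = X (fold srefl vs p) s" if s: "s \<in> tor D" for s p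
  proof -
    have "mconj (lift L ws) s = mconj t (mconj (lift M vs) s)"
      unfolding t(2) by (rule mconj_mconj[OF invertible_tor[OF t(1)] invertible_nrm[OF lift_nrm[OF M]], symmetric])
    also have "\<dots> = mconj (lift M vs) s"
      by (rule mconj_tor[OF t(1) nrm_conj_tor[OF lift_nrm[OF M] s]])
    finally show ?thesis using chr_lift[OF L s, of p ws] chr_lift[OF M s, of p vs] by simp
  qed
  then show "fold srefl ws = fold srefl vs" using chr_eqD by blast
next
  assume "fold srefl ws = fold srefl vs"
  then show "\<exists>t\<in>tor D. lift L ws = t ** lift M vs"
    by (intro nrm_coset_eq lift_nrm L M) (simp only: chr_lift[OF L] chr_lift[OF M])
qed

lemma nrm_eq_tor_lift:
  assumes L: "\<And>b. L b \<in> refl_coset b" and n: "n \<in> nrm D"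
  shows "\<exists>ws\<in>normal_words. \<exists>t\<in>tor D. n = t ** lift L ws"
proof -
  obtain ws where ws: "ws \<in> normal_words" "\<forall>t\<in>tor D. \<forall>p. X p (mconj n t) = X (fold srefl ws p) t"
    using nrm_acts_as_word[OF n] by blast
  have "\<exists>t\<in>tor D. n = t ** lift L ws"
    by (rule nrm_coset_eq[OF n lift_nrm[OF L]]) (simp only: chr_lift[OF L] ws(2))
  with ws(1) show ?thesis by blast
qed

text \<open>At \<open>x = -1\<close> the product \<open>u\<^sub>\<alpha>(x) u\<^bsub>-\<alpha>\<^esub>(-1/x) u\<^sub>\<alpha>(x)\<close> is the inverse of \<open>\<sigma>\<^sub>\<alpha>\<close>, while the
  realization makes it \<open>\<alpha>\<^sup>\<or>(-1) \<sigma>\<^sub>\<alpha>\<close>.\<close>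

lemma sigma_square:
  assumes a: "a \<in> {alpha1, alpha2}"
  shows "sigma_lift D a ** sigma_lift D a = cor D a (-1)"
proof -
  let ?s = "sigma_lift D a" and ?u = "ru D a" and ?v = "ru D (- a)"
  note R = realization_facts[OF a]
  have na: "- a \<in> G2_roots"
  proof -
    have "- alpha1 = lat (-1, 0)" "- alpha2 = lat (0, -1)" by (simp_all add: vec3_eq_iff)
    moreover have "(-1, 0) \<in> root_coords" "(0, -1) \<in> root_coords" by (simp_all add: root_coords_def)
    ultimately show ?thesis using a unfolding G2_roots_eq by (metis empty_iff image_eqI insert_iff)
  qed
  have "additive_embedding (gp D) ?v"
    using bspec[OF real[unfolded realization_def] na] by (rule conjunct1)
  then have v: "?v (x + y) = ?v x ** ?v y" "?v x \<in> gp D" for x y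
    unfolding additive_embedding_def by auto
  have idem: "A = mat 1" if "A = A ** A" "A \<in> gp D" for A
    using that(1) matrix_left_cancel[OF invertible_gp[OF that(2)], of "mat 1" A] by simp
  have u1: "?u 1 ** ?u (-1) = mat 1"
    using R(4)[of 1 "-1"] idem[OF R(4)[of 0 0, simplified] R(5)] by simp
  have v1: "?v (-1) ** ?v 1 = mat 1"
    using v(1)[of "-1" 1] idem[OF v(1)[of 0 0, simplified] v(2)] by simp
  have cancel: "A ** ?u 1 ** ?u (-1) = A" "A ** ?v (-1) ** ?v 1 = A" for A
    by (simp_all only: matrix_mul_assoc[symmetric] u1 v1 matrix_mul_rid)
  have "?s ** (cor D a (-1) ** ?s) = ?s ** (?u (-1) ** ?v 1 ** ?u (-1))"
    using R(3)[of "-1"] by simp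
  also have "\<dots> = mat 1"
    unfolding sigma_lift_def matrix_mul_assoc cancel u1 ..
  finally have inv: "?s ** (cor D a (-1) ** ?s) = mat 1" .
  have "?s ** cor D a (-1) = cor D a (-1) ** ?s"
  proof (cases "a = alpha1")
    case True
    then show ?thesis
      using refl_coset_coord[OF sigma_refl_coset[of True], of "-1" 1] by (simp add: coord_def cor_one)
  next
    case False
    then show ?thesis
      using a refl_coset_coord[OF sigma_refl_coset[of False], of 1 "-1"] by (simp add: coord_def cor_one)
  qed
  with inv have "cor D a (-1) ** (?s ** ?s) = mat 1" by (simp add: matrix_mul_assoc)
  moreover have "cor D a (-1) ** cor D a (-1) = mat 1"
    using cor_mult[OF a, of "-1" "-1"] cor_one[OF a] by simp
  moreover have "invertible (cor D a (-1))"
    using cor_tor[OF a] by (intro invertible_tor) simp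
  ultimately show ?thesis using matrix_left_cancel by metis
qed

end


section \<open>The braid relation\<close>

abbreviation longest :: "bool list" where
  "longest \<equiv> [True, False, True, False, True, False]"

abbreviation longest' :: "bool list" where
  "longest' \<equiv> [False, True, False, True, False, True]"

lemma fold_srefl_longest: "fold srefl longest p = (- fst p, - snd p)"
  by (cases p) simp

lemma fold_srefl_longest': "fold srefl longest' = fold srefl longest"
  by (rule fold_srefl_eqI) simp_all

context realized_G2
begin

lemma refl_coset_coord_iff:
  "n \<in> refl_coset b \<longleftrightarrow> (\<exists>x y. x \<noteq> 0 \<and> y \<noteq> 0 \<and> n = coord D x y ** sigma_lift D (root b))"
  unfolding refl_coset_iff by (metis coord_tor tor_coord_cases)

lemma sigma_square_coord:
  "sigma_lift D alpha1 ** sigma_lift D alpha1 = coord D (-1) 1"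
  "sigma_lift D alpha2 ** sigma_lift D alpha2 = coord D 1 (-1)"
  using sigma_square[of alpha1] sigma_square[of alpha2] by (simp_all add: coord_def cor_one)

lemma square_lift1:
  assumes "a \<noteq> 0" "b \<noteq> 0"
  shows "(coord D a b ** sigma_lift D alpha1) ** (coord D a b ** sigma_lift D alpha1) = coord D (- b) (b\<^sup>2)"
proof -
  have "(coord D a b ** sigma_lift D alpha1) ** (coord D a b ** sigma_lift D alpha1) =
      coord D a b ** (sigma_lift D alpha1 ** coord D a b) ** sigma_lift D alpha1"
    by (simp add: matrix_mul_assoc)
  also have "\<dots> = coord D a b ** coord D (b / a) b ** (sigma_lift D alpha1 ** sigma_lift D alpha1)"
    using refl_coset_coord[OF sigma_refl_coset[of True] assms] by (simp add: matrix_mul_assoc)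
  finally show ?thesis using assms by (simp add: sigma_square_coord coord_mult power2_eq_square)
qed

lemma square_lift2:
  assumes "c \<noteq> 0" "d \<noteq> 0"
  shows "(coord D c d ** sigma_lift D alpha2) ** (coord D c d ** sigma_lift D alpha2) = coord D (c\<^sup>2) (- (c ^ 3))"
proof -
  have "(coord D c d ** sigma_lift D alpha2) ** (coord D c d ** sigma_lift D alpha2) =
      coord D c d ** (sigma_lift D alpha2 ** coord D c d) ** sigma_lift D alpha2"
    by (simp add: matrix_mul_assoc)
  also have "\<dots> = coord D c d ** coord D c (c ^ 3 / d) ** (sigma_lift D alpha2 ** sigma_lift D alpha2)"
    using refl_coset_coord[OF sigma_refl_coset[of False] assms] by (simp add: matrix_mul_assoc)
  finally show ?thesis using assms by (simp add: sigma_square_coord coord_mult power2_eq_square)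
qed

lemma square_refl_coset_tor:
  assumes "n \<in> refl_coset b"
  shows "n ** n \<in> tor D"
proof -
  obtain x y where "x \<noteq> 0" "y \<noteq> 0" "n = coord D x y ** sigma_lift D (root b)"
    using assms unfolding refl_coset_coord_iff by blast
  then show ?thesis
    by (cases b) (simp_all add: square_lift1 square_lift2 coord_tor)
qed

context
  fixes L assumes L: "\<And>b. L b \<in> refl_coset b"
begin

text \<open>The longest element acts on \<open>T\<close> by inversion, so commuting with a lift of it means being
  equal to one's own inverse.\<close>

lemma longest_commute_iff:
  assumes z: "z \<in> tor D" and ws: "fold srefl ws = fold srefl longest"
  shows "lift L ws ** z = z ** lift L ws \<longleftrightarrow> z ** z = mat 1"
proof -
  let ?A = "lift L ws"
  have m: "mconj ?A z \<in> tor D" by (rule nrm_conj_tor[OF lift_nrm[OF L] z])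
  have "X (x, y) (mconj ?A z ** z) = X (x, y) (mat 1)" for x y
  proof -
    have "X (x, y) (mconj ?A z ** z) = X (- x, - y) z * X (x, y) z"
      using chr_lift[OF L z, of "(x, y)" ws] chr_mult[OF m z, of "(x, y)"]
      by (simp only: ws fold_srefl_longest fst_conv snd_conv)
    also have "\<dots> = X (0, 0) z" using chr_add[OF z, of "- x" x "- y" y] by simp
    also have "\<dots> = X (x, y) (mat 1)"
      using chr_zero[OF z] chr_mult[OF tor_one tor_one, of "(x, y)"] chr_nonzero[OF tor_one, of "(x, y)"]
      by simp
    finally show ?thesis .
  qed
  then have "mconj ?A z ** z = mat 1" by (intro tor_eqI tor_mult m z tor_one)
  moreover have "?A ** z = z ** ?A \<longleftrightarrow> mconj ?A z = z"
    using mconj_eq_iff[OF invertible_nrm[OF lift_nrm[OF L]]] by metis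
  ultimately show ?thesis using matrix_right_cancel[OF invertible_tor[OF z]] by metis
qed

text \<open>Write \<open>A\<close> and \<open>B\<close> for the two lifts of the longest element.  Then \<open>n\<^sub>1 B = A n\<^sub>1\<close> and
  \<open>n\<^sub>2 A = B n\<^sub>2\<close> are identities between words, so for \<open>A = B\<close> both \<open>n\<^sub>i\<close> commute with \<open>A\<close>.\<close>

lemma braid_imp_fourth_power:
  assumes braid: "lift L longest = lift L longest'"
  shows "(L b ** L b) ** (L b ** L b) = mat 1"
proof -
  let ?A = "lift L longest"
  have "L b ** ?A = ?A ** L b"
  proof (cases b)
    case True
    have "L True ** lift L longest' = ?A ** L True" by (simp add: matrix_mul_assoc)
    with True braid show ?thesis by simp
  next
    case False
    have "L False ** ?A = lift L longest' ** L False" by (simp add: matrix_mul_assoc)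
    with False braid show ?thesis by simp
  qed
  then have "?A ** (L b ** L b) = (L b ** L b) ** ?A"
    by (metis matrix_mul_assoc)
  then show ?thesis
    using longest_commute_iff[OF square_refl_coset_tor[OF L[of b]], of longest] by simp
qed

text \<open>Besides the word identities \<open>n\<^sub>1 B = A n\<^sub>1\<close> and \<open>n\<^sub>2 A = B n\<^sub>2\<close>, the hypothesis provides
  \<open>n\<^sub>1 A = B n\<^sub>1\<close> and \<open>n\<^sub>2 B = A n\<^sub>2\<close>.  Together they show that \<open>A = t B\<close> implies \<open>t n\<^sub>i t = n\<^sub>i\<close>, that
  is, both simple reflections invert \<open>t\<close>.\<close>

lemma fourth_power_imp_braid:
  assumes four: "\<And>b. (L b ** L b) ** (L b ** L b) = mat 1"
  shows "lift L longest = lift L longest'"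
proof -
  let ?A = "lift L longest" and ?B = "lift L longest'"
  obtain t where t: "t \<in> tor D" "?A = t ** ?B"
    using lift_coset_iff[OF L L, of longest longest'] fold_srefl_longest' by auto
  (* The square of L b commutes with L b and with the whole word, hence with the remaining letters. *)
  have swap: "L b ** lift L (b # ws) = lift L ws ** L b ** L b"
    if "fold srefl (b # ws) = fold srefl longest" for b ws
  proof -
    let ?z = "L b ** L b"
    have "lift L (b # ws) ** ?z = ?z ** lift L (b # ws)"
      using longest_commute_iff[OF square_refl_coset_tor[OF L[of b]] that] four by simp
    then have "L b ** (lift L ws ** ?z) = L b ** (L b ** lift L (b # ws))"
      by (simp add: matrix_mul_assoc)
    then have "lift L ws ** ?z = L b ** lift L (b # ws)"
      by (rule matrix_left_cancel[OF invertible_nrm[OF refl_coset_nrm[OF L]]])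
    then show ?thesis by (simp add: matrix_mul_assoc)
  qed
  have sym: "t ** L b ** t = L b" for b
  proof -
    have "L b ** ?B = t ** (L b ** ?A)"
    proof (cases b)
      case True
      have "L True ** ?B = ?A ** L True" by (simp add: matrix_mul_assoc)
      moreover have "L True ** ?A = ?B ** L True"
        using swap[of True "[False, True, False, True, False]"] by (simp add: matrix_mul_assoc)
      ultimately show ?thesis using True by (simp only: t(2) matrix_mul_assoc)
    next
      case False
      have "L False ** ?A = ?B ** L False" by (simp add: matrix_mul_assoc)
      moreover have "L False ** ?B = ?A ** L False"
        using swap[of False "[True, False, True, False, True]"] fold_srefl_longest'
        by (simp add: matrix_mul_assoc)
      ultimately show ?thesis using False by (simp only: t(2) matrix_mul_assoc)
    qed
    then have "L b ** ?B = (t ** L b ** t) ** ?B" by (simp only: t(2) matrix_mul_assoc)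
    then show ?thesis
      using matrix_right_cancel[OF invertible_nrm[OF lift_nrm[OF L]]] by metis
  qed
  obtain p q where pq: "p \<noteq> 0" "q \<noteq> 0" "t = coord D p q" using tor_coord_cases[OF t(1)] .
  have one: "s = mat 1" if "s ** L b = L b" for s b
    using that matrix_right_cancel[OF invertible_nrm[OF refl_coset_nrm[OF L[of b]]], of s "mat 1"] by simp
  have "coord D p q ** coord D (q / p) q ** L True = L True"
    using sym[of True] refl_coset_coord[OF L[of True] pq(1,2)] pq(3) by (simp add: matrix_mul_assoc[symmetric])
  then have "coord D q (q * q) = mat 1" using one pq by (simp add: coord_mult)
  then have "q = 1" using pq by (simp add: coord_eq_one_iff)
  have "coord D p q ** coord D p (p ^ 3 / q) ** L False = L False"
    using sym[of False] refl_coset_coord[OF L[of False] pq(1,2)] pq(3) by (simp add: matrix_mul_assoc[symmetric])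
  then have "coord D (p * p) (p ^ 3) = mat 1" using one pq by (simp add: coord_mult)
  then have "p * p = 1 \<and> p ^ 3 = 1" using pq by (simp add: coord_eq_one_iff)
  then have "p = 1" by (metis mult_1 power3_eq_cube)
  with \<open>q = 1\<close> show ?thesis using t(2) pq(3) by (simp add: coord_one)
qed

end

text \<open>Rewriting a word letter by letter uses only braid moves and cancellations.  Without
  cancellation the length and the lifted product are kept; a cancellation shortens the word, and
  keeps the product when the lifts are involutions.  The first case serves reduced words, the
  second one the homomorphic sections.\<close>

lemma normal_form:
  fixes L :: "bool \<Rightarrow> 'f^'n^'n"
  assumes braid: "lift L longest = lift L longest'"
  shows "\<exists>vs\<in>normal_words. fold srefl vs = fold srefl ws \<and> length vs \<le> length ws \<and>
    (length vs = length ws \<or> (\<forall>b. L b ** L b = mat 1) \<longrightarrow> lift L vs = lift L ws)"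
proof (induction ws)
  case Nil
  show ?case by (rule bexI[of _ "[]"]) (auto simp: normal_words_def)
next
  case (Cons b ws)
  then obtain vs where vs: "vs \<in> normal_words" "fold srefl vs = fold srefl ws" "length vs \<le> length ws"
    "length vs = length ws \<or> (\<forall>b. L b ** L b = mat 1) \<longrightarrow> lift L vs = lift L ws" by blast
  have fold: "fold srefl (b # ws) = fold srefl (b # vs)" using vs(2) by simp
  have srefl2: "srefl b (srefl b p) = p" for p by (cases b; cases p) simp_all
  consider "b # vs \<in> normal_words" | us where "us \<in> normal_words" "vs = b # us"
    | "b # vs = longest'" | "b # vs = longest' @ [False]"
    using normal_words_step[OF vs(1), of b] by auto
  then show ?case
  proof cases
    case 1
    then show ?thesis using vs fold by (intro bexI[of _ "b # vs"]) auto
  next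
    case 2
    have "fold srefl us = fold srefl (b # vs)" using 2(2) srefl2 by (auto simp: fun_eq_iff)
    moreover have "lift L us = lift L (b # ws)" if "\<forall>b. L b ** L b = mat 1"
    proof -
      have "lift L (b # ws) = L b ** (L b ** lift L us)" using vs(4) that 2(2) by simp
      then show ?thesis using that by (simp add: matrix_mul_assoc)
    qed
    ultimately show ?thesis using 2 vs(3) fold by (intro bexI[of _ us]) auto
  next
    case 3
    have "longest \<in> normal_words" by (simp add: normal_words_def)
    moreover have "length longest = Suc (length vs)" using 3 by simp
    moreover have "lift L longest = L b ** lift L vs" using braid 3 by (metis lift_simps(2))
    ultimately show ?thesis using vs fold 3 fold_srefl_longest' by (intro bexI[of _ longest]) auto
  next
    case 4
    let ?us = "[True, False, True, False, True]"
    have "fold srefl (b # vs) = fold srefl ?us"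
      unfolding 4 by (rule fold_srefl_eqI) simp_all
    moreover have "lift L ?us = lift L (b # ws)" if "\<forall>b. L b ** L b = mat 1"
    proof -
      have "lift L (b # ws) = lift L (b # vs)" using vs(4) that by simp
      also have "\<dots> = lift L longest ** L False" unfolding 4 lift_append braid by simp
      also have "lift L longest = lift L ?us ** L False" by (simp add: matrix_mul_assoc)
      finally show ?thesis using that by (simp add: matrix_mul_assoc[symmetric])
    qed
    moreover have "?us \<in> normal_words" by (simp add: normal_words_def)
    moreover have "length ?us < length (b # ws)" using vs(3) arg_cong[OF 4, of length] by simp
    ultimately show ?thesis using fold by (intro bexI[of _ ?us]) auto
  qed
qed

lemma normal_words_shortest:
  assumes "vs \<in> normal_words" "fold srefl ws = fold srefl vs"
  shows "length vs \<le> length ws"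
proof -
  (* Only the statement about lengths is wanted, so the trivial lift will do. *)
  have "lift (\<lambda>_. mat 1 :: 'f^'n^'n) longest = lift (\<lambda>_. mat 1) longest'" by simp
  from normal_form[OF this, of ws] obtain us
    where "us \<in> normal_words" "fold srefl us = fold srefl ws" "length us \<le> length ws" by blast
  then show ?thesis using assms normal_words_separated by metis
qed


section \<open>The Weyl group\<close>

lemma weyl_proj_eq_iff:
  "weyl_proj D m = weyl_proj D n \<longleftrightarrow> (\<exists>t\<in>tor D. m = t ** n)" if "m \<in> nrm D" "n \<in> nrm D"
proof
  assume "weyl_proj D m = weyl_proj D n"
  moreover have "m \<in> weyl_proj D m"
    unfolding weyl_proj_eq using tor_one by (intro CollectI exI[of _ "mat 1"]) simp
  ultimately show "\<exists>t\<in>tor D. m = t ** n" unfolding weyl_proj_eq by blast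
next
  assume "\<exists>t\<in>tor D. m = t ** n"
  then obtain t where t: "t \<in> tor D" "m = t ** n" by blast
  have "s ** m = (s ** t) ** n" "s ** n = (s ** matrix_inv t) ** m" for s
    using matrix_inv_inverts(2)[OF invertible_tor[OF t(1)]]
    by (simp_all add: t(2) matrix_mul_assoc) (simp add: matrix_mul_assoc[symmetric])
  then show "weyl_proj D m = weyl_proj D n"
    unfolding weyl_proj_eq using tor_mult t(1) tor_inv[OF t(1)] by blast
qed

lemma carrier_weyl: "carrier (weyl D) = weyl_proj D ` nrm D"
  by (auto simp: weyl_def FactGroup_def RCOSETS_def weyl_proj_def r_coset_def)

lemma one_weyl: "\<one>\<^bsub>weyl D\<^esub> = weyl_proj D (mat 1)"
  by (auto simp: weyl_def FactGroup_def weyl_proj_eq)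

lemma mult_weyl:
  assumes m: "m \<in> nrm D" and n: "n \<in> nrm D"
  shows "weyl_proj D m \<otimes>\<^bsub>weyl D\<^esub> weyl_proj D n = weyl_proj D (m ** n)"
proof -
  have move: "(s ** m) ** (t ** n) = (s ** mconj m t) ** (m ** n)" for s t
  proof -
    have "mconj m t ** m = m ** t" using mconj_eq_iff[OF invertible_nrm[OF m], of t] by metis
    then show ?thesis by (metis matrix_mul_assoc)
  qed
  have eq: "(\<exists>s\<in>tor D. \<exists>t\<in>tor D. x = (s ** m) ** (t ** n)) \<longleftrightarrow> (\<exists>s\<in>tor D. x = s ** (m ** n))" for x
  proof
    assume "\<exists>s\<in>tor D. x = s ** (m ** n)"
    then obtain s where s: "s \<in> tor D" "x = s ** (m ** n)" by blast
    have "mconj m (mat 1) = mat 1" by (simp add: matrix_inv_inverts invertible_nrm[OF m])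
    then have "x = (s ** m) ** (mat 1 ** n)" unfolding move using s(2) by simp
    with s(1) tor_one show "\<exists>s\<in>tor D. \<exists>t\<in>tor D. x = (s ** m) ** (t ** n)" by blast
  qed (use move tor_mult nrm_conj_tor[OF m] in blast)
  have "x \<in> weyl_proj D m \<otimes>\<^bsub>weyl D\<^esub> weyl_proj D n \<longleftrightarrow>
      (\<exists>s\<in>tor D. \<exists>t\<in>tor D. x = (s ** m) ** (t ** n))" for x
    unfolding weyl_def FactGroup_def weyl_proj_eq set_mult_def by simp blast
  then show ?thesis unfolding eq weyl_proj_eq[of "m ** n"] by blast
qed

lemma refl_coset_eq_weyl_proj:
  assumes "n \<in> refl_coset b"
  shows "refl_coset b = weyl_proj D n"
proof -
  have "weyl_proj D n = weyl_proj D (sigma_lift D (root b))"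
    using assms refl_coset_nrm[OF assms] refl_coset_nrm[OF sigma_refl_coset[of b]]
    by (subst weyl_proj_eq_iff) (auto simp: refl_coset_iff)
  then show ?thesis using realization_facts(2)[of "root b"] by simp
qed

lemma word_prod_lift:
  assumes "\<And>b. L b \<in> refl_coset b"
  shows "word_prod D (map refl_coset ws) = weyl_proj D (lift L ws)"
proof (induction ws)
  case Nil
  show ?case by (simp add: word_prod_def one_weyl)
next
  case (Cons b ws)
  then have "word_prod D (map refl_coset (b # ws)) = weyl_proj D (L b) \<otimes>\<^bsub>weyl D\<^esub> weyl_proj D (lift L ws)"
    using refl_coset_eq_weyl_proj[OF assms[of b]] by (simp add: word_prod_def)
  also have "\<dots> = weyl_proj D (L b ** lift L ws)"
    by (rule mult_weyl[OF refl_coset_nrm[OF assms] lift_nrm[OF assms]])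
  finally show ?case by simp
qed

lemma word_prod_eq_iff:
  "word_prod D (map refl_coset ws) = word_prod D (map refl_coset vs) \<longleftrightarrow> fold srefl ws = fold srefl vs"
  unfolding word_prod_lift[of "\<lambda>b. sigma_lift D (root b)", OF sigma_refl_coset]
    weyl_proj_eq_iff[OF lift_nrm[OF sigma_refl_coset] lift_nrm[OF sigma_refl_coset]]
  by (rule lift_coset_iff[OF sigma_refl_coset sigma_refl_coset])

lemma weyl_normal_word:
  assumes "w \<in> carrier (weyl D)"
  obtains ws where "ws \<in> normal_words" "w = word_prod D (map refl_coset ws)"
proof -
  let ?L = "\<lambda>b. sigma_lift D (root b)"
  obtain n where n: "n \<in> nrm D" "w = weyl_proj D n" using assms carrier_weyl by blast
  obtain ws where ws: "ws \<in> normal_words" "\<exists>t\<in>tor D. n = t ** lift ?L ws"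
    using nrm_eq_tor_lift[of ?L, OF sigma_refl_coset n(1)] by blast
  then have "w = word_prod D (map refl_coset ws)"
    unfolding n(2) word_prod_lift[of ?L, OF sigma_refl_coset]
    using weyl_proj_eq_iff[OF n(1) lift_nrm[of ?L, OF sigma_refl_coset]] by blast
  with ws(1) show thesis by (rule that)
qed

lemma word_prod_carrier: "word_prod D (map refl_coset ws) \<in> carrier (weyl D)"
  unfolding word_prod_lift[of "\<lambda>b. sigma_lift D (root b)", OF sigma_refl_coset] carrier_weyl
  by (intro imageI lift_nrm sigma_refl_coset)

lemma word_prod_append:
  "word_prod D (map refl_coset (ws @ vs)) =
    word_prod D (map refl_coset ws) \<otimes>\<^bsub>weyl D\<^esub> word_prod D (map refl_coset vs)"
  unfolding word_prod_lift[of "\<lambda>b. sigma_lift D (root b)", OF sigma_refl_coset] lift_append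
  by (rule mult_weyl[symmetric]) (intro lift_nrm sigma_refl_coset)+

lemma word_prod_single: "word_prod D [refl_coset b] = refl_coset b"
  using word_prod_lift[of "\<lambda>b. sigma_lift D (root b)" "[b]", OF sigma_refl_coset]
    refl_coset_eq_weyl_proj[OF sigma_refl_coset[of b]] by simp

lemma refl_coset_carrier: "refl_coset b \<in> carrier (weyl D)"
  using word_prod_carrier[of "[b]"] word_prod_single[of b] by simp

lemma simple_refls_word: "set ws \<subseteq> simple_refls D \<longleftrightarrow> (\<exists>bs. ws = map refl_coset bs)"
proof -
  have "simple_refls D = refl_coset ` UNIV" by (auto simp: simple_refls_def UNIV_bool)
  then show ?thesis unfolding ex_map_conv by blast
qed

lemma reduced_iff:
  "reduced D (map refl_coset ws) \<longleftrightarrow> (\<forall>vs. fold srefl vs = fold srefl ws \<longrightarrow> length ws \<le> length vs)"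
  unfolding reduced_def simple_refls_word
  by (metis (no_types, lifting) length_map word_prod_eq_iff)

lemma reduced_normal_word: "ws \<in> normal_words \<Longrightarrow> reduced D (map refl_coset ws)"
  unfolding reduced_iff using normal_words_shortest by blast


section \<open>Sections\<close>

lemma section_refl_coset:
  assumes "is_section D S"
  shows "S (refl_coset b) \<in> refl_coset b"
proof -
  have "S (refl_coset b) \<in> nrm D" "weyl_proj D (S (refl_coset b)) = refl_coset b"
    using assms refl_coset_carrier[of b] unfolding is_section_def by (blast intro: PiE_mem)+
  moreover have "n \<in> weyl_proj D n" for n
    unfolding weyl_proj_eq using tor_one by (intro CollectI exI[of _ "mat 1"]) simp
  ultimately show ?thesis by metis
qed

lemma section_reduced:
  assumes "is_section D S" "reduced D (map refl_coset ws)"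
  shows "S (word_prod D (map refl_coset ws)) = lift (\<lambda>b. S (refl_coset b)) ws"
  using assms unfolding is_section_def lift_def by (simp add: comp_def)

lemma section_braid:
  assumes "is_section D S"
  shows "lift (\<lambda>b. S (refl_coset b)) longest = lift (\<lambda>b. S (refl_coset b)) longest'"
proof -
  have "longest \<in> normal_words" by (simp add: normal_words_def)
  then have red: "reduced D (map refl_coset longest)" by (rule reduced_normal_word)
  moreover have "reduced D (map refl_coset longest')"
    using red unfolding reduced_iff fold_srefl_longest' by simp
  moreover have "word_prod D (map refl_coset longest) = word_prod D (map refl_coset longest')"
    by (simp only: word_prod_eq_iff fold_srefl_longest')
  ultimately show ?thesis using section_reduced[OF assms] by metis
qed

lemma section_eqI:
  assumes S: "is_section D S" and S': "is_section D S'"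
    and eq: "\<And>b. S (refl_coset b) = S' (refl_coset b)"
  shows "S = S'"
proof (rule extensionalityI)
  show "S \<in> extensional (carrier (weyl D))" "S' \<in> extensional (carrier (weyl D))"
    using S S' unfolding is_section_def by (auto simp: PiE_def)
  fix w assume "w \<in> carrier (weyl D)"
  then obtain ws where "ws \<in> normal_words" "w = word_prod D (map refl_coset ws)"
    by (rule weyl_normal_word)
  then show "S w = S' w"
    using section_reduced[OF S] section_reduced[OF S'] reduced_normal_word eq by simp
qed

text \<open>A section is defined through normal words.  A reduced word has the length of its normal form,
  so \<open>normal_form\<close> equates the two lifted products.\<close>

lemma section_exists:
  assumes L: "\<And>b. L b \<in> refl_coset b" and braid: "lift L longest = lift L longest'"
  shows "\<exists>S. is_section D S \<and> (\<forall>b. S (refl_coset b) = L b)"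
proof -
  define nf where "nf w = (THE ws. ws \<in> normal_words \<and> word_prod D (map refl_coset ws) = w)" for w
  have nf: "nf (word_prod D (map refl_coset ws)) = ws" if "ws \<in> normal_words" for ws
    unfolding nf_def word_prod_eq_iff
    by (rule the_equality) (use that normal_words_separated in auto)
  define S where "S = restrict (\<lambda>w. lift L (nf w)) (carrier (weyl D))"
  have S_normal: "S (word_prod D (map refl_coset ws)) = lift L ws" if "ws \<in> normal_words" for ws
    using word_prod_carrier nf[OF that] by (simp add: S_def)
  have "S \<in> carrier (weyl D) \<rightarrow>\<^sub>E nrm D"
    unfolding S_def using lift_nrm[OF L] by auto
  moreover have "weyl_proj D (S w) = w" if "w \<in> carrier (weyl D)" for w
  proof -
    obtain ws where "ws \<in> normal_words" "w = word_prod D (map refl_coset ws)"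
      using \<open>w \<in> carrier (weyl D)\<close> by (rule weyl_normal_word)
    then show ?thesis using S_normal word_prod_lift[OF L] by simp
  qed
  moreover have "S (word_prod D (map refl_coset bs)) = lift L bs"
    if red: "reduced D (map refl_coset bs)" for bs
  proof -
    obtain vs where vs: "vs \<in> normal_words" "fold srefl vs = fold srefl bs" "length vs \<le> length bs"
      "length vs = length bs \<longrightarrow> lift L vs = lift L bs"
      using normal_form[OF braid, of bs] by blast
    have "length bs \<le> length vs" using red vs(2) unfolding reduced_iff by blast
    with vs have "lift L vs = lift L bs" by simp
    moreover have "word_prod D (map refl_coset bs) = word_prod D (map refl_coset vs)"
      unfolding word_prod_eq_iff vs(2) ..
    ultimately show ?thesis using S_normal[OF vs(1)] by simp
  qed
  moreover have S_refl: "S (refl_coset b) = L b" for b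
    using S_normal[of "[b]"] word_prod_single[of b] by (cases b) (simp_all add: normal_words_def)
  moreover have "foldr (**) (map S (map refl_coset bs)) (mat 1) = lift L bs" for bs
    by (simp add: lift_def comp_def S_refl)
  ultimately have "is_section D S"
    unfolding is_section_def using simple_refls_word reduced_def by metis
  with S_refl show ?thesis by blast
qed

lemma section_homomorphic:
  assumes S: "is_section D S" and inv: "\<And>b. S (refl_coset b) ** S (refl_coset b) = mat 1"
  shows "homomorphic D S"
proof -
  let ?L = "\<lambda>b. S (refl_coset b)"
  have lift: "S (word_prod D (map refl_coset ws)) = lift ?L ws" for ws
  proof -
    obtain vs where vs: "vs \<in> normal_words" "fold srefl vs = fold srefl ws" "lift ?L vs = lift ?L ws"
      using normal_form[OF section_braid[OF S], of ws] inv by blast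
    then have "word_prod D (map refl_coset ws) = word_prod D (map refl_coset vs)"
      unfolding word_prod_eq_iff by simp
    then show ?thesis using section_reduced[OF S reduced_normal_word[OF vs(1)]] vs(3) by simp
  qed
  have "S \<in> hom (weyl D) (grp (nrm D))"
  proof (rule homI)
    show "S w \<in> carrier (grp (nrm D))" if "w \<in> carrier (weyl D)" for w
      using S that unfolding is_section_def by auto
    fix v w assume v: "v \<in> carrier (weyl D)" and w: "w \<in> carrier (weyl D)"
    obtain vs where "v = word_prod D (map refl_coset vs)" using weyl_normal_word[OF v] .
    moreover obtain ws where "w = word_prod D (map refl_coset ws)" using weyl_normal_word[OF w] .
    ultimately show "S (v \<otimes>\<^bsub>weyl D\<^esub> w) = S v \<otimes>\<^bsub>grp (nrm D)\<^esub> S w"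
      using lift[of "vs @ ws"] word_prod_append[of vs ws] lift[of vs] lift[of ws]
      by (simp add: lift_append)
  qed
  with S show ?thesis by (simp add: homomorphic_def)
qed

end


section \<open>Coordinates of sections\<close>

lemma elt_order_eq:
  fixes A :: "'f::field^'n^'n"
  assumes A: "invertible A" "A \<noteq> mat 1" and four: "(A ** A) ** (A ** A) = mat 1"
  shows "elt_order A = (if A ** A = mat 1 then 2 else 4)"
proof -
  interpret group "GL :: ('f^'n^'n) monoid" by (rule group_GL)
  have G: "A \<in> carrier GL" using A by simp
  have pow: "A [^]\<^bsub>GL\<^esub> n = mat 1 \<longleftrightarrow> ord A dvd n" for n :: nat
    using pow_eq_id[OF G] by simp
  have "A [^]\<^bsub>GL\<^esub> (1::nat) = A" "A [^]\<^bsub>GL\<^esub> (2::nat) = A ** A"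
    "A [^]\<^bsub>GL\<^esub> (4::nat) = (A ** A) ** (A ** A)"
    by (simp_all add: numeral_eq_Suc matrix_mul_assoc)
  then have d: "\<not> ord A dvd 1" "ord A dvd 2 \<longleftrightarrow> A ** A = mat 1" "ord A dvd 4"
    using pow[of 1] pow[of 2] pow[of 4] A four by simp_all
  have "ord A \<le> 4" using d(3) by (rule dvd_imp_le) simp
  then have "ord A \<in> {0, 1, 2, 3, 4}" by auto
  then have "ord A = (if A ** A = mat 1 then 2 else 4)"
    using d by auto
  then show ?thesis by (simp add: elt_order_def numeral_eq_enat)
qed

context realized_G2
begin

lemma refl_coset_neq_one:
  assumes "n \<in> refl_coset b"
  shows "n \<noteq> mat 1"
proof
  assume n: "n = mat 1"
  have "X p t = X (srefl b p) t" if "t \<in> tor D" for t p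
    using chr_refl_coset[OF assms that, of p] unfolding n mconj_one .
  then have "srefl b p = p" for p using chr_eqD by metis
  from this[of "(1, 0)"] this[of "(0, 1)"] show False by (cases b) simp_all
qed

lemma square_lift_eq_one_iff:
  assumes "x \<noteq> 0" "y \<noteq> 0"
  shows "b\<^sup>2 = 1 \<Longrightarrow> (coord D x b ** sigma_lift D alpha1) ** (coord D x b ** sigma_lift D alpha1) = mat 1 \<longleftrightarrow> b = -1"
    and "c\<^sup>2 = 1 \<Longrightarrow> (coord D c y ** sigma_lift D alpha2) ** (coord D c y ** sigma_lift D alpha2) = mat 1 \<longleftrightarrow> c = -1"
proof -
  have neg: "- z = 1 \<longleftrightarrow> z = -1" for z :: 'f by (metis minus_minus)
  assume b: "b\<^sup>2 = 1"
  then have "b \<noteq> 0" by auto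
  then have "coord D (- b) (b\<^sup>2) = mat 1 \<longleftrightarrow> - b = 1"
    using b by (simp add: coord_eq_one_iff)
  then show "(coord D x b ** sigma_lift D alpha1) ** (coord D x b ** sigma_lift D alpha1) = mat 1 \<longleftrightarrow> b = -1"
    unfolding square_lift1[OF assms(1) \<open>b \<noteq> 0\<close>] neg .
next
  have neg: "- z = 1 \<longleftrightarrow> z = -1" for z :: 'f by (metis minus_minus)
  assume c: "c\<^sup>2 = 1"
  then have "c \<noteq> 0" by auto
  moreover have "c ^ 3 = c" using c by (simp add: power3_eq_cube power2_eq_square)
  ultimately have "coord D (c\<^sup>2) (- (c ^ 3)) = mat 1 \<longleftrightarrow> - c = 1"
    using c by (simp add: coord_eq_one_iff)
  then show "(coord D c y ** sigma_lift D alpha2) ** (coord D c y ** sigma_lift D alpha2) = mat 1 \<longleftrightarrow> c = -1"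
    unfolding square_lift2[OF \<open>c \<noteq> 0\<close> assms(2)] neg .
qed

lemma fourth_power_lift_iff:
  assumes "a \<noteq> 0" "b \<noteq> 0" "c \<noteq> 0" "d \<noteq> 0"
  defines "A \<equiv> coord D a b ** sigma_lift D alpha1" and "B \<equiv> coord D c d ** sigma_lift D alpha2"
  shows "(A ** A) ** (A ** A) = mat 1 \<longleftrightarrow> b\<^sup>2 = 1" "(B ** B) ** (B ** B) = mat 1 \<longleftrightarrow> c\<^sup>2 = 1"
proof -
  have "(A ** A) ** (A ** A) = mat 1 \<longleftrightarrow> b * b = 1 \<and> b\<^sup>2 * b\<^sup>2 = 1"
    unfolding A_def using assms by (simp add: square_lift1 coord_mult coord_eq_one_iff)
  then show "(A ** A) ** (A ** A) = mat 1 \<longleftrightarrow> b\<^sup>2 = 1"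
    by (auto simp: power2_eq_square)
  have "(B ** B) ** (B ** B) = mat 1 \<longleftrightarrow> c\<^sup>2 * c\<^sup>2 = 1 \<and> c ^ 3 * c ^ 3 = 1"
    unfolding B_def using assms by (simp add: square_lift2 coord_mult coord_eq_one_iff)
  also have "c ^ 3 * c ^ 3 = (c\<^sup>2 * c\<^sup>2) * c\<^sup>2"
    by (simp add: power2_eq_square power3_eq_cube)
  also have "c\<^sup>2 * c\<^sup>2 = 1 \<and> (c\<^sup>2 * c\<^sup>2) * c\<^sup>2 = 1 \<longleftrightarrow> c\<^sup>2 = 1"
    by (metis mult_1)
  finally show "(B ** B) ** (B ** B) = mat 1 \<longleftrightarrow> c\<^sup>2 = 1" .
qed

abbreviation coord_lift :: "'f \<Rightarrow> 'f \<Rightarrow> 'f \<Rightarrow> 'f \<Rightarrow> bool \<Rightarrow> 'f^'n^'n" where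
  "coord_lift a b c d i \<equiv> if i then coord D a b ** sigma_lift D alpha1 else coord D c d ** sigma_lift D alpha2"

lemma section_with_iff:
  "section_with D a b c d S \<longleftrightarrow> is_section D S \<and> a \<noteq> 0 \<and> b \<noteq> 0 \<and> c \<noteq> 0 \<and> d \<noteq> 0 \<and>
    (\<forall>i. S (refl_coset i) = coord_lift a b c d i)"
  unfolding section_with_def by (auto simp: all_bool_eq)

lemma coord_lift_refl_coset:
  assumes "a \<noteq> 0" "b \<noteq> 0" "c \<noteq> 0" "d \<noteq> 0"
  shows "coord_lift a b c d i \<in> refl_coset i"
  using assms unfolding refl_coset_coord_iff by (cases i) auto

lemma section_with_squares:
  assumes "section_with D a b c d S"
  shows "b\<^sup>2 = 1" "c\<^sup>2 = 1"
proof -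
  have S: "is_section D S" and nz: "a \<noteq> 0" "b \<noteq> 0" "c \<noteq> 0" "d \<noteq> 0"
    and eq: "\<And>i. S (refl_coset i) = coord_lift a b c d i"
    using assms unfolding section_with_iff by auto
  have "(S (refl_coset i) ** S (refl_coset i)) ** (S (refl_coset i) ** S (refl_coset i)) = mat 1" for i
    by (rule braid_imp_fourth_power[OF section_refl_coset[OF S] section_braid[OF S]])
  from this[of True] this[of False] show "b\<^sup>2 = 1" "c\<^sup>2 = 1"
    unfolding eq using fourth_power_lift_iff[OF nz] by simp_all
qed

lemma section_with_exists1:
  assumes nz: "a \<noteq> 0" "d \<noteq> 0" and sq: "b\<^sup>2 = 1" "c\<^sup>2 = 1"
  shows "\<exists>!S. section_with D a b c d S"
proof -
  have nz': "a \<noteq> 0" "b \<noteq> 0" "c \<noteq> 0" "d \<noteq> 0" using nz sq by auto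
  note L = coord_lift_refl_coset[OF nz']
  have "(coord_lift a b c d i ** coord_lift a b c d i) ** (coord_lift a b c d i ** coord_lift a b c d i) = mat 1" for i
    using fourth_power_lift_iff[OF nz'] sq by (cases i) simp_all
  from section_exists[OF L fourth_power_imp_braid[OF L this]]
  obtain S where "is_section D S" "\<forall>i. S (refl_coset i) = coord_lift a b c d i" by blast
  with nz' have "section_with D a b c d S" unfolding section_with_iff by blast
  moreover have "S' = S" if "section_with D a b c d S'" for S'
    using that calculation unfolding section_with_iff by (intro section_eqI) auto
  ultimately show ?thesis by blast
qed

lemma section_has_coordinates:
  assumes "is_section D S"
  obtains a b c d where "section_with D a b c d S"
proof -
  obtain a b where "a \<noteq> 0" "b \<noteq> 0" "S (refl_coset True) = coord D a b ** sigma_lift D (root True)"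
    using section_refl_coset[OF assms, of True] unfolding refl_coset_coord_iff by blast
  moreover obtain c d where "c \<noteq> 0" "d \<noteq> 0" "S (refl_coset False) = coord D c d ** sigma_lift D (root False)"
    using section_refl_coset[OF assms, of False] unfolding refl_coset_coord_iff by blast
  ultimately show thesis using assms by (intro that[of a b c d]) (simp add: section_with_def)
qed

lemma order_profile_section:
  assumes "section_with D a b c d S"
  shows "order_profile D S = (if b = -1 then 2 else 4, if c = -1 then 2 else 4)"
proof -
  have S: "is_section D S" and nz: "a \<noteq> 0" "b \<noteq> 0" "c \<noteq> 0" "d \<noteq> 0"
    and eq: "\<And>i. S (refl_coset i) = coord_lift a b c d i"
    using assms unfolding section_with_iff by auto
  note sq = section_with_squares[OF assms]
  have "elt_order (S (refl_coset i)) =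
      (if S (refl_coset i) ** S (refl_coset i) = mat 1 then 2 else 4)" for i
    using section_refl_coset[OF S, of i]
    by (intro elt_order_eq refl_coset_neq_one[of _ i] invertible_nrm refl_coset_nrm[of _ i]
        braid_imp_fourth_power[OF section_refl_coset[OF S] section_braid[OF S]]) auto
  from this[of True] this[of False] show ?thesis
    using eq[of True] eq[of False] square_lift_eq_one_iff[OF nz(1,4)] sq
    by (simp add: order_profile_def)
qed

text \<open>For \<open>t = (x, y)\<close> the conjugate of \<open>(a, b) \<sigma>\<^sub>1\<close> is \<open>(\<alpha>\<^sub>1(t) a, b) \<sigma>\<^sub>1\<close>, and that of \<open>(c, d) \<sigma>\<^sub>2\<close> is
  \<open>(c, \<alpha>\<^sub>2(t) d) \<sigma>\<^sub>2\<close>, with \<open>\<alpha>\<^sub>1(t) = x\<^sup>2 / y\<close> and \<open>\<alpha>\<^sub>2(t) = y\<^sup>2 / x\<^sup>3\<close>.\<close>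

lemma T_conjugate_iff:
  assumes S: "section_with D a b c d S" and S': "section_with D a' b' c' d' S'"
  shows "T_conjugate D S S' \<longleftrightarrow> b = b' \<and> c = c'"
proof -
  have nz: "a \<noteq> 0" "b \<noteq> 0" "c \<noteq> 0" "d \<noteq> 0" and nz': "a' \<noteq> 0" "b' \<noteq> 0" "c' \<noteq> 0" "d' \<noteq> 0"
    and sec: "is_section D S" "is_section D S'"
    and eq: "\<And>i. S (refl_coset i) = coord_lift a b c d i"
      "\<And>i. S' (refl_coset i) = coord_lift a' b' c' d' i"
    using S S' unfolding section_with_iff by auto
  have conj: "mconj (coord D x y) (S (refl_coset i)) = S' (refl_coset i) \<longleftrightarrow>
      (if i then b = b' \<and> a' * y = a * x\<^sup>2 else c = c' \<and> d' * x ^ 3 = d * y\<^sup>2)"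
    if xy: "x \<noteq> 0" "y \<noteq> 0" for x y i
  proof -
    let ?s = "sigma_lift D (root i)"
    let ?l = "if i then coord D (x * a) (y * b) else coord D (x * c) (y * d)"
    let ?r = "if i then coord D (a' * (y / x)) (b' * y) else coord D (c' * x) (d' * (x ^ 3 / y))"
    have s: "?s ** coord D x y = (if i then coord D (y / x) y else coord D x (x ^ 3 / y)) ** ?s"
      by (rule refl_coset_coord[OF sigma_refl_coset xy])
    have l: "coord D x y ** S (refl_coset i) = ?l ** ?s"
      unfolding eq using xy nz by (cases i) (simp_all add: matrix_mul_assoc coord_mult)
    have r: "S' (refl_coset i) ** coord D x y = ?r ** ?s"
    proof -
      have "S' (refl_coset i) ** coord D x y =
          (if i then coord D a' b' else coord D c' d') ** (?s ** coord D x y)"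
        unfolding eq by (cases i) (simp_all add: matrix_mul_assoc)
      then show ?thesis
        unfolding s using xy nz' by (cases i) (simp_all add: matrix_mul_assoc coord_mult)
    qed
    have cancel: "A ** ?s = B ** ?s \<longleftrightarrow> A = B" for A B
      using matrix_right_cancel[OF invertible_nrm[OF refl_coset_nrm[OF sigma_refl_coset[of i]]]] by blast
    have "?l = ?r \<longleftrightarrow> (if i then b = b' \<and> a' * y = a * x\<^sup>2 else c = c' \<and> d' * x ^ 3 = d * y\<^sup>2)"
    proof (cases i)
      case True
      have "x * a = a' * (y / x) \<longleftrightarrow> a' * y = a * x\<^sup>2" "y * b = b' * y \<longleftrightarrow> b = b'"
        using xy by (auto simp: field_simps power2_eq_square)
      then show ?thesis using True xy nz nz' by (simp add: coord_eq_iff) blast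
    next
      case False
      have "x * c = c' * x \<longleftrightarrow> c = c'" "y * d = d' * (x ^ 3 / y) \<longleftrightarrow> d' * x ^ 3 = d * y\<^sup>2"
        using xy by (auto simp: field_simps power2_eq_square)
      then show ?thesis using False xy nz nz' by (simp add: coord_eq_iff)
    qed
    then show ?thesis
      by (subst mconj_eq_iff[OF invertible_tor[OF coord_tor[OF xy]]]) (simp only: l r cancel)
  qed
  show ?thesis
  proof
    assume "T_conjugate D S S'"
    then obtain t where t: "t \<in> tor D" "\<forall>w\<in>carrier (weyl D). mconj t (S w) = S' w"
      unfolding T_conjugate_def by blast
    obtain x y where xy: "x \<noteq> 0" "y \<noteq> 0" "t = coord D x y" using tor_coord_cases[OF t(1)] .
    show "b = b' \<and> c = c'"
      using t(2) conj[OF xy(1,2), of True] conj[OF xy(1,2), of False] refl_coset_carrier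
      unfolding xy(3) by (metis (full_types))
  next
    assume bc: "b = b' \<and> c = c'"
    define u where "u = a' / a"
    define v where "v = d' / d"
    (* The exponents invert the Cartan matrix: these solve x^2 / y = u and y^2 / x^3 = v. *)
    let ?x = "u\<^sup>2 * v" and ?y = "u ^ 3 * v\<^sup>2"
    have uv: "u \<noteq> 0" "v \<noteq> 0" "a' = u * a" "d' = v * d" using nz nz' by (simp_all add: u_def v_def)
    then have xy: "?x \<noteq> 0" "?y \<noteq> 0" by simp_all
    let ?t = "coord D ?x ?y"
    have inv: "invertible ?t" using xy by (intro invertible_tor coord_tor)
    have simple: "mconj ?t (S (refl_coset i)) = S' (refl_coset i)" for i
      unfolding conj[OF xy] using bc uv(3,4)
      by (auto simp: power2_eq_square power3_eq_cube algebra_simps)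
    have "mconj ?t (lift (\<lambda>i. S (refl_coset i)) ws) = lift (\<lambda>i. S' (refl_coset i)) ws" for ws
    proof (induction ws)
      case Nil
      then show ?case by (simp add: matrix_inv_inverts inv)
    next
      case (Cons i ws)
      then show ?case using simple[of i] by (simp only: lift_simps mconj_mult[OF inv])
    qed
    moreover have "\<exists>ws. S w = lift (\<lambda>i. S (refl_coset i)) ws \<and> S' w = lift (\<lambda>i. S' (refl_coset i)) ws"
      if w: "w \<in> carrier (weyl D)" for w
    proof -
      obtain ws where "ws \<in> normal_words" "w = word_prod D (map refl_coset ws)"
        using weyl_normal_word[OF w] .
      then show ?thesis using section_reduced[OF sec(1) reduced_normal_word] section_reduced[OF sec(2) reduced_normal_word]
        by blast
    qed
    ultimately have "mconj ?t (S w) = S' w" if "w \<in> carrier (weyl D)" for w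
      using that by metis
    then show "T_conjugate D S S'" unfolding T_conjugate_def using coord_tor[OF xy] by blast
  qed
qed

lemma order_profiles_cases:
  assumes "p \<in> order_profiles D"
  shows "p \<in> {(2, 2), (2, 4), (4, 2), (4, 4)}"
proof -
  obtain S where S: "is_section D S" "p = order_profile D S"
    using assms unfolding order_profiles_def by blast
  obtain a b c d where "section_with D a b c d S" using section_has_coordinates[OF S(1)] .
  from order_profile_section[OF this] show ?thesis unfolding S(2) by simp
qed

text \<open>Orders \<open>2\<close> and \<open>4\<close> are the only ones that occur, so the profile \<open>(2, 2)\<close> lies above all others.\<close>

lemma optimal_section:
  assumes S: "section_with D a (-1) (-1) d S"
  shows "optimal D S"
proof -
  have sec: "is_section D S" using S by (simp add: section_with_def)
  have p: "order_profile D S = (2, 2)" using order_profile_section[OF S] by simp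
  have in_profiles: "(2, 2) \<in> order_profiles D"
    unfolding order_profiles_def p[symmetric] using sec by (intro imageI CollectI)
  have "q = (2, 2) \<or> profile_less q (2, 2)" "\<not> profile_less (2, 2) q"
    if "q \<in> order_profiles D" for q
    using order_profiles_cases[OF that] by (auto simp: profile_less_def)
  then have "maximal_profile D q \<longleftrightarrow> q = (2, 2)" for q
    unfolding maximal_profile_def using in_profiles by metis
  then show ?thesis unfolding optimal_def p using sec by blast
qed

end


theorem proposition3p17:
  fixes D :: "('f::alg_closed_field, 'n::finite) datum"
  assumes "connected_reductive (gp D)" and "almost_simple (gp D)"
    and "maximal_torus (tor D) (gp D)"
    and "type_G2 D" and "realization D"
  shows
    "(\<forall>a d. a \<noteq> 0 \<and> d \<noteq> 0 \<longrightarrow> (\<exists>!S. section_with D a (-1) (-1) d S)) \<and>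
     (\<forall>a d S. section_with D a (-1) (-1) d S \<longrightarrow> optimal D S \<and> homomorphic D S) \<and>
     (\<exists>!S. tits_section D S) \<and>
     ((2::'f) \<noteq> 0 \<longrightarrow> (\<forall>S. tits_section D S \<longrightarrow> \<not> optimal D S \<and>
        S (reflection D alpha1) ** S (reflection D alpha1) \<noteq> mat 1 \<and>
        S (reflection D alpha2) ** S (reflection D alpha2) \<noteq> mat 1)) \<and>
     ((2::'f) \<noteq> 0 \<longrightarrow> order_profiles D = {(2, 2), (2, 4), (4, 2), (4, 4)}) \<and>
     (\<forall>a b c d. a \<noteq> 0 \<and> d \<noteq> 0 \<and> b\<^sup>2 = 1 \<and> c\<^sup>2 = 1 \<longrightarrow>
        ((coord D a b ** sigma_lift D alpha1) ** (coord D a b ** sigma_lift D alpha1) = mat 1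
           \<longleftrightarrow> b = -1) \<and>
        ((coord D c d ** sigma_lift D alpha2) ** (coord D c d ** sigma_lift D alpha2) = mat 1
           \<longleftrightarrow> c = -1)) \<and>
     ((2::'f) \<noteq> 0 \<longrightarrow> (\<forall>a b c d S. section_with D a b c d S \<longrightarrow>
        (order_profile D S = (2, 4) \<longleftrightarrow> b = -1 \<and> c = 1) \<and>
        (order_profile D S = (4, 2) \<longleftrightarrow> b = 1 \<and> c = -1))) \<and>
     (\<forall>S S'. is_section D S \<and> is_section D S' \<longrightarrow>
        (T_conjugate D S S' \<longleftrightarrow>
           (\<exists>a a' b c d d'. section_with D a b c d S \<and> section_with D a' b c d' S')) \<and>
        (T_conjugate D S S' \<longleftrightarrow> order_profile D S = order_profile D S'))"
proof -
  interpret realized_G2 D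
    by standard (use assms in \<open>auto simp: connected_reductive_def\<close>)
  have tits: "tits_section D S \<longleftrightarrow> section_with D 1 1 1 1 S" for S
    by (simp add: tits_section_def section_with_def coord_one)
  have ne: "(1::'f) \<noteq> -1" if "(2::'f) \<noteq> 0"
    using that by (metis add.right_inverse one_add_one)
  have pm1: "z = 1 \<or> z = -1" if "z\<^sup>2 = 1" for z :: 'f
    using that by (simp add: power2_eq_1_iff)
  have homo: "homomorphic D S" if S: "section_with D a (-1) (-1) d S" for a d S
  proof (rule section_homomorphic)
    show "is_section D S" using S by (simp add: section_with_def)
    fix i
    have "a \<noteq> 0" "d \<noteq> 0"
      "S (reflection D alpha1) = coord D a (-1) ** sigma_lift D alpha1"
      "S (reflection D alpha2) = coord D (-1) d ** sigma_lift D alpha2"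
      using S by (simp_all add: section_with_def)
    then show "S (refl_coset i) ** S (refl_coset i) = mat 1"
      by (cases i) (simp_all add: square_lift_eq_one_iff)
  qed
  have profile_in: "order_profile D S \<in> order_profiles D" if "section_with D a b c d S" for a b c d S
    using that unfolding order_profiles_def section_with_def by (intro imageI CollectI) simp
  have 1: "\<exists>!S. section_with D a (-1) (-1) d S" if "a \<noteq> 0 \<and> d \<noteq> 0" for a d
    by (rule section_with_exists1) (use that in simp_all)
  have 3: "\<exists>!S. tits_section D S"
    unfolding tits by (rule section_with_exists1) simp_all
  have 4: "\<not> optimal D S \<and> S (reflection D alpha1) ** S (reflection D alpha1) \<noteq> mat 1 \<and>
        S (reflection D alpha2) ** S (reflection D alpha2) \<noteq> mat 1"
    if two: "(2::'f) \<noteq> 0" and S: "tits_section D S" for S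
  proof (intro conjI)
    have S1: "section_with D 1 1 1 1 S" using S unfolding tits .
    show "S (reflection D alpha1) ** S (reflection D alpha1) \<noteq> mat 1"
      "S (reflection D alpha2) ** S (reflection D alpha2) \<noteq> mat 1"
      using S1 two square_lift_eq_one_iff(1)[of 1 1 1] square_lift_eq_one_iff(2)[of 1 1 1]
      by (simp_all add: section_with_def)
    have p: "order_profile D S = (4, 4)" using order_profile_section[OF S1] ne[OF two] by simp
    obtain S' where S': "section_with D 1 (-1) (-1) 1 S'" using 1[of 1 1] by auto
    have "order_profile D S' = (2, 2)" using order_profile_section[OF S'] by simp
    then have "(2, 2) \<in> order_profiles D" using profile_in[OF S'] by simp
    moreover have "profile_less (4, 4) (2, 2)" by (simp add: profile_less_def)
    ultimately have "\<not> maximal_profile D (order_profile D S)"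
      unfolding maximal_profile_def p by blast
    then show "\<not> optimal D S" unfolding optimal_def by blast
  qed
  have 5: "order_profiles D = {(2, 2), (2, 4), (4, 2), (4, 4)}" if two: "(2::'f) \<noteq> 0"
  proof
    have "(if b = -1 then 2 else 4, if c = -1 then 2 else 4) \<in> order_profiles D"
      if sq: "b\<^sup>2 = 1" "c\<^sup>2 = 1" for b c :: 'f
    proof -
      obtain S where "section_with D 1 b c 1 S" using section_with_exists1[OF one_neq_zero one_neq_zero sq] by blast
      then show ?thesis using profile_in order_profile_section by metis
    qed
    from this[of "-1" "-1"] this[of "-1" 1] this[of 1 "-1"] this[of 1 1]
    show "{(2, 2), (2, 4), (4, 2), (4, 4)} \<subseteq> order_profiles D" using ne[OF two] by simp
  qed (use order_profiles_cases in blast)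
  have 7: "(order_profile D S = (2, 4) \<longleftrightarrow> b = -1 \<and> c = 1) \<and>
        (order_profile D S = (4, 2) \<longleftrightarrow> b = 1 \<and> c = -1)"
    if two: "(2::'f) \<noteq> 0" and S: "section_with D a b c d S" for a b c d S
    using order_profile_section[OF S] pm1[OF section_with_squares(1)[OF S]]
      pm1[OF section_with_squares(2)[OF S]] ne[OF two] by auto
  have 8: "(T_conjugate D S S' \<longleftrightarrow>
           (\<exists>a a' b c d d'. section_with D a b c d S \<and> section_with D a' b c d' S')) \<and>
        (T_conjugate D S S' \<longleftrightarrow> order_profile D S = order_profile D S')"
    if SS': "is_section D S \<and> is_section D S'" for S S'
  proof -
    obtain a b c d where S: "section_with D a b c d S"
      using section_has_coordinates[OF conjunct1[OF SS']] .
    obtain a' b' c' d' where S': "section_with D a' b' c' d' S'"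
      using section_has_coordinates[OF conjunct2[OF SS']] .
    have "order_profile D S = order_profile D S' \<longleftrightarrow> b = b' \<and> c = c'"
      using order_profile_section[OF S] order_profile_section[OF S']
        pm1[OF section_with_squares(1)[OF S]] pm1[OF section_with_squares(2)[OF S]]
        pm1[OF section_with_squares(1)[OF S']] pm1[OF section_with_squares(2)[OF S']]
      by auto
    moreover have "T_conjugate D S S' \<longleftrightarrow> b = b' \<and> c = c'" by (rule T_conjugate_iff[OF S S'])
    moreover have "T_conjugate D S S' \<longleftrightarrow>
        (\<exists>a a' b c d d'. section_with D a b c d S \<and> section_with D a' b c d' S')"
      using S S' T_conjugate_iff by metis
    ultimately show ?thesis by blast
  qed
  have 2: "optimal D S \<and> homomorphic D S" if "section_with D a (-1) (-1) d S" for a d S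
    using optimal_section[OF that] homo[OF that] ..
  have 6: "((coord D a b ** sigma_lift D alpha1) ** (coord D a b ** sigma_lift D alpha1) = mat 1
           \<longleftrightarrow> b = -1) \<and>
        ((coord D c d ** sigma_lift D alpha2) ** (coord D c d ** sigma_lift D alpha2) = mat 1
           \<longleftrightarrow> c = -1)"
    if "a \<noteq> 0 \<and> d \<noteq> 0 \<and> b\<^sup>2 = 1 \<and> c\<^sup>2 = 1" for a b c d
    using that square_lift_eq_one_iff[of a d] by simp
  show ?thesis
    by (rule conjI, intro allI impI, erule 1,
        rule conjI, intro allI impI, erule 2,
        rule conjI, rule 3,
        rule conjI, intro allI impI, erule (1) 4,
        rule conjI, rule impI, erule 5,
        rule conjI, intro allI impI, erule 6,
        rule conjI, intro allI impI, erule (1) 7,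
        intro allI impI, erule 8)
qed

end
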